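(* Let $X=(x_1,\dots,x_p)\in\mathbb{R}^{n\times p}$, $y\in\mathbb{R}^n$, $\beta^*\in\mathbb{R}^p$, $\lambda_0>0$ and $\xi>1$. Let $(\widehat\beta,\widehat\sigma)$ be the scaled lasso estimator with parameter $\lambda_0$, $\sigma^*=|y-X\beta^*|_2/n^{1/2}>0$ and $z^*=|X'(y-X\beta^* )/n|_\infty/\sigma^*$. Let $\eta_*(\lambda,\xi)$ be as defined in the context and $\tau_0=\eta_*^{1/2}(\sigma^*\lambda_0,\xi)/\sigma^*$. When $z^*\le(1-\tau_0)\lambda_0(\xi-1)/(\xi+1)$, $$\max\Big(1-\frac{\widehat\sigma}{\sigma^*},\,1-\frac{\sigma^*}{\widehat\sigma}\Big)\le\tau_0,\qquad \frac{|X\widehat\beta-X\beta^*|_2}{n^{1/2}\sigma^*}\le\frac1{\sigma^*}\eta_*^{1/2}\Big(\frac{\sigma^*\lambda_0}{1-\tau_0},\xi\Big)\le\frac{\tau_0}{1-\tau_0}.$$ In particular, suppose $n\to\infty$ and $p\to\infty$ ($X$, $\beta^*$, $\sigma>0$, $p$ may all depend on $n$), with $|x_j|_2^2=n$ for all $j$. If $\lambda_0=A\{(2/n)\log p\}^{1/2}$ with constants $\xi>1$ and $A>(\xi+1)/(\xi-1)$, and $\eta_*(\sigma\lambda_0,\xi)/\sigma^2\to0$, then $$\mathrm{pr}_{\beta^*,\sigma}\big(|\widehat\sigma/\sigma-1|>\epsilon\big)\to0$$ for all $\epsilon>0$.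
   Context: $|v|_q$ is the $\ell_q$ norm, $|v|_\infty=\max_j|v_j|$; $v_T$ is the subvector of $v$ with indices in $T$; $T^c=\{1,\dots,p\}\setminus T$. $\mathrm{pr}_{\beta,\sigma}$ is the probability measure under which $y-X\beta\sim N(0,\sigma^2I_n)$ ($X$ deterministic). Scaled lasso: $(\widehat\beta,\widehat\sigma)=\arg\min_{\beta\in\mathbb{R}^p,\,\sigma>0}\big\{|y-X\beta|_2^2/(2n\sigma)+\sigma/2+\lambda_0|\beta|_1\big\}$. For $\xi>1$, $T\subset\{1,\dots,p\}$, let $\mathscr{C}(\xi,T)=\{u\in\mathbb{R}^p:|u_{T^c}|_1\le\xi|u_T|_1\}$ and let the compatibility factor be $$\kappa(\xi,T)=\min\Big\{\frac{|T|^{1/2}|Xu|_2}{n^{1/2}|u_T|_1}:u\in\mathscr{C}(\xi,T),\,u\ne0\Big\}.$$ For $\lambda>0$, $w\in\mathbb{R}^p$, let $\delta_{w,T}=1-I(w=\beta^*,T=\emptyset)$ ($I$ is the indicator) and $$\eta(\lambda,\xi,w,T)=\frac{|X\beta^*-Xw|_2^2}{n}+(1+\delta_{w,T})\,2\lambda|w_{T^c}|_1+\frac{4\xi^2\lambda^2|T|}{(\xi+1)^2\kappa^2(\xi,T)},$$ $$\eta_*(\lambda,\xi)=\inf_{w\in\mathbb{R}^p,\,T\subset\{1,\dots,p\}}\eta(\lambda,\xi,w,T).$$ The last term of $\eta$ is $0$ when $T=\emptyset$ and $+\infty$ when $T\neq\emptyset$, $\kappa(\xi,T)=0$. Quantities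 with denominator $1-\tau_0$ are read as $+\infty$ if $\tau_0=1$. *)

theory Defs
  imports "HOL-Probability.Probability" "Jordan_Normal_Form.Matrix"
begin

no_notation vec_nth (infixl \<open>$\<close> 90)

text \<open>Coordinates are 0-based: $\{1,\dots,p\}$ becomes \<open>{..<p}\<close>. Throughout, \<open>X\<close> is the
  $n\times p$ design matrix, so $n$ is \<open>dim_row X\<close> and $p$ is \<open>dim_col X\<close>.\<close>

definition l1_norm_on :: "nat set \<Rightarrow> real vec \<Rightarrow> real" where
  "l1_norm_on T v = (\<Sum>j\<in>T. \<bar>v $ j\<bar>)"

definition l1_norm :: "real vec \<Rightarrow> real" where
  "l1_norm v = (\<Sum>j<dim_vec v. \<bar>v $ j\<bar>)"

definition l2_norm :: "real vec \<Rightarrow> real" where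
  "l2_norm v = sqrt (\<Sum>j<dim_vec v. (v $ j)\<^sup>2)"

(* The inserted 0 only matters for the empty vector. *)
definition linf_norm :: "real vec \<Rightarrow> real" where
  "linf_norm v = Max (insert 0 ((\<lambda>j. \<bar>v $ j\<bar>) ` {..<dim_vec v}))"

definition scaled_lasso_objective ::
    "real mat \<Rightarrow> real vec \<Rightarrow> real \<Rightarrow> real vec \<times> real \<Rightarrow> real" where
  "scaled_lasso_objective X y lam0 = (\<lambda>(\<beta>, \<sigma>).
     (l2_norm (y - X *\<^sub>v \<beta>))\<^sup>2 / (2 * real (dim_row X) * \<sigma>) + \<sigma> / 2 + lam0 * l1_norm \<beta>)"

text \<open>A predicate rather than a function: the minimizer need not be unique, and the infimum over
  \<open>\<sigma> > 0\<close> need not be attained (e.g. for \<open>y = 0\<close>).\<close>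

definition is_scaled_lasso ::
    "real mat \<Rightarrow> real vec \<Rightarrow> real \<Rightarrow> real vec \<Rightarrow> real \<Rightarrow> bool" where
  "is_scaled_lasso X y lam0 \<beta>h \<sigma>h \<longleftrightarrow>
     is_arg_min (scaled_lasso_objective X y lam0)
       (\<lambda>(\<beta>, \<sigma>). \<beta> \<in> carrier_vec (dim_col X) \<and> \<sigma> > 0) (\<beta>h, \<sigma>h)"

definition cone :: "nat \<Rightarrow> real \<Rightarrow> nat set \<Rightarrow> real vec set" where
  "cone p \<xi> T = {u \<in> carrier_vec p. l1_norm_on ({..<p} - T) u \<le> \<xi> * l1_norm_on T u}"

(* For nonempty T the infimum is attained; for T = {} the set is empty and the value is
   unspecified, but eta does not use it. *)
definition compat_factor :: "real mat \<Rightarrow> real \<Rightarrow> nat set \<Rightarrow> real" where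
  "compat_factor X \<xi> T =
     Inf {sqrt (real (card T)) * l2_norm (X *\<^sub>v u) / (sqrt (real (dim_row X)) * l1_norm_on T u) |
            u. u \<in> cone (dim_col X) \<xi> T \<and> u \<noteq> 0\<^sub>v (dim_col X)}"

definition eta ::
    "real mat \<Rightarrow> real vec \<Rightarrow> real \<Rightarrow> real \<Rightarrow> real vec \<Rightarrow> nat set \<Rightarrow> ereal" where
  "eta X \<beta>s lam \<xi> w T =
     (let \<delta> = (if w = \<beta>s \<and> T = {} then 0 else 1 :: real); \<kappa> = compat_factor X \<xi> T in
      ereal ((l2_norm (X *\<^sub>v \<beta>s - X *\<^sub>v w))\<^sup>2 / real (dim_row X)
             + (1 + \<delta>) * (2 * lam * l1_norm_on ({..<dim_col X} - T) w))
      + (if T = {} then 0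
         else if \<kappa> = 0 then \<infinity>
         else ereal (4 * \<xi>\<^sup>2 * lam\<^sup>2 * real (card T) / ((\<xi> + 1)\<^sup>2 * \<kappa>\<^sup>2))))"

(* The infimum is finite because T = {} is allowed. *)
definition eta_star :: "real mat \<Rightarrow> real vec \<Rightarrow> real \<Rightarrow> real \<Rightarrow> real" where
  "eta_star X \<beta>s lam \<xi> =
     real_of_ereal (INF w\<in>carrier_vec (dim_col X). INF T\<in>Pow {..<dim_col X}. eta X \<beta>s lam \<xi> w T)"

definition sigma_star :: "real mat \<Rightarrow> real vec \<Rightarrow> real vec \<Rightarrow> real" where
  "sigma_star X y \<beta>s = l2_norm (y - X *\<^sub>v \<beta>s) / sqrt (real (dim_row X))"

definition z_star :: "real mat \<Rightarrow> real vec \<Rightarrow> real vec \<Rightarrow> real" where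
  "z_star X y \<beta>s =
     linf_norm ((1 / real (dim_row X)) \<cdot>\<^sub>v (X\<^sup>T *\<^sub>v (y - X *\<^sub>v \<beta>s))) / sigma_star X y \<beta>s"

definition tau0 :: "real mat \<Rightarrow> real vec \<Rightarrow> real vec \<Rightarrow> real \<Rightarrow> real \<Rightarrow> real" where
  "tau0 X y \<beta>s lam0 \<xi> = sqrt (eta_star X \<beta>s (sigma_star X y \<beta>s * lam0) \<xi>) / sigma_star X y \<beta>s"

text \<open>The Borel sets of $\mathbb{R}^n$, transported to \<open>carrier_vec n\<close>.\<close>

definition vec_borel :: "nat \<Rightarrow> real vec measure" where
  "vec_borel n = vimage_algebra (carrier_vec n) (\<lambda>v. \<lambda>i\<in>{..<n}. v $ i) (\<Pi>\<^sub>M i\<in>{..<n}. borel)"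

text \<open>The law of \<open>y\<close> under which \<open>y - X \<beta>\<close> has independent $N(0,\sigma^2)$ coordinates.\<close>

definition gauss_pr :: "real mat \<Rightarrow> real vec \<Rightarrow> real \<Rightarrow> real vec measure" where
  "gauss_pr X \<beta> \<sigma> =
     distr (\<Pi>\<^sub>M i\<in>{..<dim_row X}. density lborel (\<lambda>x. ennreal (normal_density 0 \<sigma> x)))
       (vec_borel (dim_row X)) (\<lambda>e. X *\<^sub>v \<beta> + Matrix.vec (dim_row X) e)"

lemma measurable_gauss_pr_map:
  assumes [simp]: "dim_row X = n"
  shows "(\<lambda>e. X *\<^sub>v \<beta> + Matrix.vec n e) \<in>
    (\<Pi>\<^sub>M i\<in>{..<n}. density lborel (\<lambda>x. ennreal (normal_density 0 \<sigma> x))) \<rightarrow>\<^sub>M vec_borel n"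
  unfolding vec_borel_def
proof (rule measurable_vimage_algebra2)
  show "(\<lambda>e. X *\<^sub>v \<beta> + Matrix.vec n e) \<in>
    space (\<Pi>\<^sub>M i\<in>{..<n}. density lborel (\<lambda>x. ennreal (normal_density 0 \<sigma> x))) \<rightarrow> carrier_vec n"
    by (intro funcsetI carrier_vecI) simp
  let ?M = "\<Pi>\<^sub>M i\<in>{..<n}. density lborel (\<lambda>x. ennreal (normal_density 0 \<sigma> x))"
  have "(\<lambda>e. \<lambda>i\<in>{..<n}. (X *\<^sub>v \<beta> + Matrix.vec n e) $ i) =
      (\<lambda>e. \<lambda>i\<in>{..<n}. (X *\<^sub>v \<beta>) $ i + e i)"
    by (intro ext) (simp add: restrict_def)
  moreover have "(\<lambda>e. \<lambda>i\<in>{..<n}. (X *\<^sub>v \<beta>) $ i + e i) \<in> ?M \<rightarrow>\<^sub>M (\<Pi>\<^sub>M i\<in>{..<n}. borel)"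
  proof (rule measurable_restrict)
    fix i assume i: "i \<in> {..<n}"
    have "(\<lambda>e. e i) \<in> ?M \<rightarrow>\<^sub>M density lborel (\<lambda>x. ennreal (normal_density 0 \<sigma> x))"
      using i by (rule measurable_component_singleton)
    also have "?M \<rightarrow>\<^sub>M density lborel (\<lambda>x. ennreal (normal_density 0 \<sigma> x)) = borel_measurable ?M"
      by (rule measurable_cong_sets) (rule refl, simp only: sets_density sets_lborel)
    finally show "(\<lambda>e. (X *\<^sub>v \<beta>) $ i + e i) \<in> borel_measurable ?M"
      by (intro borel_measurable_add borel_measurable_const)
  qed
  ultimately show "(\<lambda>e. \<lambda>i\<in>{..<n}. (X *\<^sub>v \<beta> + Matrix.vec n e) $ i) \<in> ?M \<rightarrow>\<^sub>M (\<Pi>\<^sub>M i\<in>{..<n}. borel)"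
    by (simp only:)
qed

lemma prob_space_gauss_pr:
  assumes "\<sigma> > 0"
  shows "prob_space (gauss_pr X \<beta> \<sigma>)"
proof -
  interpret N: prob_space "density lborel (\<lambda>x. ennreal (normal_density 0 \<sigma> x))"
    using assms by (rule prob_space_normal_density)
  interpret prob_space "\<Pi>\<^sub>M i\<in>{..<dim_row X}. density lborel (\<lambda>x. ennreal (normal_density 0 \<sigma> x))"
    by (rule prob_space_PiM) (rule N.prob_space_axioms)
  show ?thesis
    unfolding gauss_pr_def
    using measurable_gauss_pr_map[where X = X and \<beta> = \<beta> and \<sigma> = \<sigma>, OF refl]
    by (rule prob_space_distr)
qed

end

theory Submission
  imports Defs "HOL-Real_Asymp.Real_Asymp"
begin

text \<open>Minimising over \<open>\<sigma>\<close> turns the scaled lasso into the square-root lasso, whose solution \<open>b\<close> with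
  residual level \<open>s = |y - X b|\<^sub>2 / n\<^sup>1\<^sup>/\<^sup>2 > 0\<close> is also a lasso solution at level \<open>s \<lambda>\<^sub>0\<close>. The variational
  inequality of the lasso gives the oracle inequality \<open>|X b - X \<beta>\<^sup>*|\<^sub>2\<^sup>2 / n \<le> \<eta>\<^sub>*(s \<lambda>\<^sub>0, \<xi>)\<close> as soon as
  \<open>s \<ge> (1 - \<tau>\<^sub>0) \<sigma>\<^sup>*\<close>, and \<open>\<eta>\<^sub>*(c \<lambda>, \<xi>) \<le> c\<^sup>2 \<eta>\<^sub>*(\<lambda>, \<xi>)\<close> for \<open>c \<ge> 1\<close> then bounds \<open>s\<close> from above. For the consistency
  of the noise level estimator, Chernoff bounds show that \<open>\<sigma>\<^sup>* / \<sigma>\<close> is close to 1 and that \<open>z\<^sup>*\<close> is small enough with high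
  probability.\<close>

no_notation inner (infix \<open>\<bullet>\<close> 70)

subsection \<open>Norms and inner products\<close>

text \<open>The obstacle is a circularity: the oracle inequality at level \<open>s * lam0\<close>
  needs the noise to be small relative to \<open>s\<close>, so it says nothing about the square-root
  lasso until its residual level \<open>s\<close> is known to reach the threshold
  \<open>(1 - \<tau>) * \<sigma>s\<close>. The way out is an auxiliary lasso at the deterministic
  level \<open>(1 - \<tau>) * \<sigma>s * lam0\<close>. The hypothesis on \<open>z_star\<close> is
  made for exactly this level, and the definition of \<open>\<tau>\<close> bounds its prediction
  error by \<open>\<tau> * \<sigma>s\<close>, so its own residual level is at least
  \<open>\<sigma>s - \<tau> * \<sigma>s\<close>, which is the threshold. First-order optimality then
  transfers the bound to the square-root lasso. The ratio (\<xi> - 1) / (\<xi> + 1) is the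
  noise-to-penalty ratio r with (1 + r) / (1 - r) = \<xi>, the constant of the cone. In the random
  part, A (\<xi> - 1) / (\<xi> + 1) > 1 leaves a margin. It pays for replacing
  \<open>\<sigma>s\<close> by the true noise level and \<open>1 - \<tau>\<close> by 1, and what
  remains still makes the union bound over the p columns vanish.\<close>

lemma l2_norm_eq_L2_set: "l2_norm v = L2_set (\<lambda>i. v $ i) {..<dim_vec v}"
  by (simp add: l2_norm_def L2_set_def)

lemma l2_norm_nonneg [simp]: "0 \<le> l2_norm v"
  by (simp add: l2_norm_def sum_nonneg)

lemma l2_norm_power2: "(l2_norm v)\<^sup>2 = v \<bullet> v"
  by (simp add: l2_norm_def sum_nonneg scalar_prod_def power2_eq_square lessThan_atLeast0)

lemma l2_norm_minus_power2:
  assumes "a \<in> carrier_vec n" "b \<in> carrier_vec n"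
  shows "(l2_norm (a - b))\<^sup>2 = (l2_norm a)\<^sup>2 - 2 * (a \<bullet> b) + (l2_norm b)\<^sup>2"
  using assms comm_scalar_prod[of b n a]
  by (simp add: l2_norm_power2 minus_scalar_prod_distrib[of _ n] scalar_prod_minus_distrib[of _ n])

lemma l2_norm_triangle_minus:
  assumes "a \<in> carrier_vec n" "b \<in> carrier_vec n"
  shows "l2_norm a \<le> l2_norm (a - b) + l2_norm b"
proof -
  have "L2_set (\<lambda>i. (a - b) $ i) {..<n} = L2_set (\<lambda>i. a $ i - b $ i) {..<n}"
    using assms by (intro L2_set_cong) auto
  then show ?thesis
    using L2_set_triangle_ineq[of "\<lambda>i. a $ i - b $ i" "\<lambda>i. b $ i" "{..<n}"] assms
    by (simp add: l2_norm_eq_L2_set)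
qed

lemma l2_norm_smult: "l2_norm (c \<cdot>\<^sub>v v) = \<bar>c\<bar> * l2_norm v"
  by (simp add: l2_norm_def power_mult_distrib sum_distrib_left[symmetric] real_sqrt_mult)

lemma l2_norm_minus_commute:
  assumes "a \<in> carrier_vec n" "b \<in> carrier_vec n"
  shows "l2_norm (a - b) = l2_norm (b - a)"
  using assms by (simp add: l2_norm_def power2_commute)

lemma l2_norm_eq_0_iff: "v \<in> carrier_vec n \<Longrightarrow> l2_norm v = 0 \<longleftrightarrow> v = 0\<^sub>v n"
  by (auto simp: l2_norm_eq_L2_set L2_set_eq_0_iff intro!: eq_vecI)

lemma l1_norm_on_nonneg [simp]: "0 \<le> l1_norm_on T v"
  by (simp add: l1_norm_on_def sum_nonneg)

lemma l1_norm_nonneg [simp]: "0 \<le> l1_norm v"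
  by (simp add: l1_norm_def sum_nonneg)

lemma l1_norm_split:
  assumes "v \<in> carrier_vec p" "T \<subseteq> {..<p}"
  shows "l1_norm v = l1_norm_on T v + l1_norm_on ({..<p} - T) v"
  using assms sum.subset_diff[of T "{..<p}" "\<lambda>j. \<bar>v $ j\<bar>"]
  by (simp add: l1_norm_def l1_norm_on_def)

lemma l1_norm_on_le:
  assumes "\<And>j. j \<in> T \<Longrightarrow> \<bar>a $ j\<bar> \<le> \<bar>b $ j\<bar> + \<bar>c $ j\<bar>"
  shows "l1_norm_on T a \<le> l1_norm_on T b + l1_norm_on T c"
  unfolding l1_norm_on_def sum.distrib[symmetric] using assms by (rule sum_mono)

lemma l1_norm_minus_le:
  assumes "v \<in> carrier_vec p" "w \<in> carrier_vec p"
  shows "l1_norm (v - w) \<le> l1_norm v + l1_norm w"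
  using assms by (simp add: l1_norm_def flip: sum.distrib) (auto intro!: sum_mono abs_triangle_ineq4)

text \<open>The point on the segment is written as \<open>v\<close> minus a step towards
  \<open>w\<close>, the form of the perturbation in
  \<open>lasso_variational_inequality\<close>.\<close>

lemma l1_norm_convex:
  assumes "v \<in> carrier_vec p" "w \<in> carrier_vec p" "0 \<le> s" "s \<le> 1"
  shows "l1_norm (v - s \<cdot>\<^sub>v (v - w)) \<le> (1 - s) * l1_norm v + s * l1_norm w"
proof -
  have "\<bar>v $ j - s * (v $ j - w $ j)\<bar> \<le> (1 - s) * \<bar>v $ j\<bar> + s * \<bar>w $ j\<bar>" for j
  proof -
    have "v $ j - s * (v $ j - w $ j) = (1 - s) * v $ j + s * w $ j"
      by (simp add: algebra_simps)
    then show ?thesis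
      using abs_triangle_ineq[of "(1 - s) * v $ j" "s * w $ j"] assms by (simp add: abs_mult)
  qed
  then show ?thesis
    using assms
    by (simp add: l1_norm_def sum_distrib_left flip: sum.distrib) (auto intro!: sum_mono)
qed

lemma l1_norm_eq_0_iff: "v \<in> carrier_vec p \<Longrightarrow> l1_norm v = 0 \<longleftrightarrow> v = 0\<^sub>v p"
  by (auto simp: l1_norm_def sum_nonneg_eq_0_iff intro!: eq_vecI)

lemma l1_norm_zero [simp]: "l1_norm (0\<^sub>v p) = 0"
  by (simp add: l1_norm_def)

lemma l1_norm_on_zero: "T \<subseteq> {..<p} \<Longrightarrow> l1_norm_on T (0\<^sub>v p) = 0"
  by (auto simp: l1_norm_on_def intro!: sum.neutral)

lemma linf_norm_ge: "j < dim_vec v \<Longrightarrow> \<bar>v $ j\<bar> \<le> linf_norm v"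
  by (auto simp: linf_norm_def intro!: Max_ge)

lemma linf_norm_nonneg: "0 \<le> linf_norm v"
  by (auto simp: linf_norm_def intro!: Max_ge)

lemma linf_norm_le: "0 \<le> c \<Longrightarrow> (\<And>j. j < dim_vec v \<Longrightarrow> \<bar>v $ j\<bar> \<le> c) \<Longrightarrow> linf_norm v \<le> c"
  by (auto simp: linf_norm_def)

lemma scalar_prod_le_linf_l1:
  assumes "v \<in> carrier_vec p" "u \<in> carrier_vec p"
  shows "v \<bullet> u \<le> linf_norm v * l1_norm u"
proof -
  have "v \<bullet> u = (\<Sum>j<p. v $ j * u $ j)"
    using assms by (simp add: scalar_prod_def lessThan_atLeast0)
  also have "\<dots> \<le> (\<Sum>j<p. linf_norm v * \<bar>u $ j\<bar>)"
  proof (rule sum_mono)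
    fix j assume "j \<in> {..<p}"
    then have "\<bar>v $ j\<bar> * \<bar>u $ j\<bar> \<le> linf_norm v * \<bar>u $ j\<bar>"
      using assms by (intro mult_right_mono linf_norm_ge) auto
    then show "v $ j * u $ j \<le> linf_norm v * \<bar>u $ j\<bar>"
      using abs_ge_self[of "v $ j * u $ j"] by (simp add: abs_mult)
  qed
  finally show ?thesis
    using assms by (simp add: l1_norm_def sum_distrib_left)
qed

text \<open>Transposing \<open>X\<close> and applying Hoelder turns the pairing of the noise with a
  fitted vector into the numerator of \<open>z_star\<close> times an l1 norm.\<close>

lemma scalar_prod_mat_mult_le:
  assumes "X \<in> carrier_mat n p" "e \<in> carrier_vec n" "u \<in> carrier_vec p"
  shows "e \<bullet> (X *\<^sub>v u) / real n \<le> linf_norm ((1 / real n) \<cdot>\<^sub>v (X\<^sup>T *\<^sub>v e)) * l1_norm u"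
proof -
  have "e \<bullet> (X *\<^sub>v u) = (X\<^sup>T *\<^sub>v e) \<bullet> u"
    using transpose_vec_mult_scalar[OF assms(1,3,2)] by simp
  then have "e \<bullet> (X *\<^sub>v u) / real n = ((1 / real n) \<cdot>\<^sub>v (X\<^sup>T *\<^sub>v e)) \<bullet> u"
    using assms by (simp add: smult_scalar_prod_distrib[of _ p])
  also have "\<dots> \<le> linf_norm ((1 / real n) \<cdot>\<^sub>v (X\<^sup>T *\<^sub>v e)) * l1_norm u"
    using assms by (intro scalar_prod_le_linf_l1[of _ p]) auto
  finally show ?thesis .
qed

subsection \<open>The lasso and the square-root lasso\<close>

text \<open>The factor 1 / (2n) is the scaling under which a square-root lasso at \<open>lam\<close>
  with residual level s becomes a lasso at \<open>s * lam\<close>.\<close>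

definition is_lasso :: "real mat \<Rightarrow> real vec \<Rightarrow> real \<Rightarrow> real vec \<Rightarrow> bool" where
  "is_lasso X y lam b \<longleftrightarrow> b \<in> carrier_vec (dim_col X) \<and>
     (\<forall>w\<in>carrier_vec (dim_col X).
        (l2_norm (y - X *\<^sub>v b))\<^sup>2 / (2 * real (dim_row X)) + lam * l1_norm b
        \<le> (l2_norm (y - X *\<^sub>v w))\<^sup>2 / (2 * real (dim_row X)) + lam * l1_norm w)"

text \<open>\<open>sigma_star\<close> is applied to arbitrary coefficient vectors here, so it
  denotes their residual level and not only that of the true vector.\<close>

definition is_sqrt_lasso :: "real mat \<Rightarrow> real vec \<Rightarrow> real \<Rightarrow> real vec \<Rightarrow> bool" where
  "is_sqrt_lasso X y lam b \<longleftrightarrow> b \<in> carrier_vec (dim_col X) \<and>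
     (\<forall>w\<in>carrier_vec (dim_col X).
        sigma_star X y b + lam * l1_norm b \<le> sigma_star X y w + lam * l1_norm w)"

lemma sigma_star_nonneg: "0 \<le> sigma_star X y b"
  by (simp add: sigma_star_def)

lemma sigma_star_power2: "(sigma_star X y b)\<^sup>2 = (l2_norm (y - X *\<^sub>v b))\<^sup>2 / real (dim_row X)"
  by (simp add: sigma_star_def power_divide)

text \<open>The minimum is attained on a box, which is compact as a subset of \<open>nat \<Rightarrow> real\<close> with the
  product topology.\<close>

lemma penalised_minimizer_exists:
  fixes \<phi> :: "real \<Rightarrow> real"
  assumes X: "X \<in> carrier_mat n p" and y: "y \<in> carrier_vec n" and lam: "lam > 0"
    and cont: "continuous_on UNIV \<phi>" and nonneg: "\<And>x. 0 \<le> \<phi> x"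
  obtains b where "b \<in> carrier_vec p"
    "\<And>w. w \<in> carrier_vec p \<Longrightarrow>
       \<phi> (l2_norm (y - X *\<^sub>v b)) + lam * l1_norm b \<le> \<phi> (l2_norm (y - X *\<^sub>v w)) + lam * l1_norm w"
proof -
  define F where "F = (\<lambda>w. \<phi> (l2_norm (y - X *\<^sub>v w)) + lam * l1_norm w)"
  \<comment> \<open>A competitor that beats the zero vector satisfies
    \<open>lam * l1_norm w \<le> F (0\<^sub>v p)\<close>, hence all its coordinates lie in
    [-B, B].\<close>
  define B where "B = F (0\<^sub>v p) / lam"
  have F0: "F (0\<^sub>v p) \<ge> 0"
    using lam nonneg by (simp add: F_def)
  have B: "0 \<le> B"
    using F0 lam by (simp add: B_def)
  \<comment> \<open>Coordinates from \<open>p\<close> on do not affect \<open>F\<close>, but are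
    boxed as well so that \<open>K\<close> is compact in the whole function space.\<close>
  define K where "K = PiE (UNIV :: nat set) (\<lambda>_. {-B..B})"
  have "compactin (product_topology (\<lambda>_. euclidean) UNIV) K"
    unfolding K_def by (subst compactin_PiE) auto
  then have K: "compact K"
    by (simp add: euclidean_product_topology)
  have eq: "F (Matrix.vec p g) =
      \<phi> (sqrt (\<Sum>i<n. (y $ i - (\<Sum>j<p. X $$ (i, j) * g j))\<^sup>2)) + lam * (\<Sum>j<p. \<bar>g j\<bar>)" for g
    using X y by (simp add: F_def l2_norm_def l1_norm_def scalar_prod_def lessThan_atLeast0)
  have "continuous_on K (\<lambda>g. F (Matrix.vec p g))"
    unfolding eq
    by (intro continuous_intros continuous_on_compose2[OF cont]
        continuous_on_product_then_coordinatewise[OF continuous_on_id]) auto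
  moreover have zero: "(\<lambda>_. 0) \<in> K"
    using B by (auto simp: K_def)
  ultimately obtain g where g: "g \<in> K" "\<And>g'. g' \<in> K \<Longrightarrow> F (Matrix.vec p g) \<le> F (Matrix.vec p g')"
    using continuous_attains_inf[OF K] by (metis empty_iff)
  have "F (Matrix.vec p g) \<le> F w" if w: "w \<in> carrier_vec p" for w
  proof (cases "F w \<le> F (0\<^sub>v p)")
    case True
    then have "lam * l1_norm w \<le> F (0\<^sub>v p)"
      using nonneg[of "l2_norm (y - X *\<^sub>v w)"] by (simp add: F_def)
    then have l1: "l1_norm w \<le> B"
      using lam by (simp add: B_def field_simps)
    have "\<bar>w $ j\<bar> \<le> B" if "j < p" for j
      using l1 w that member_le_sum[of j "{..<p}" "\<lambda>j. \<bar>w $ j\<bar>"] by (simp add: l1_norm_def)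
    then have "(\<lambda>j. if j < p then w $ j else 0) \<in> K"
      using B by (force simp: K_def abs_le_iff)
    moreover have "Matrix.vec p (\<lambda>j. if j < p then w $ j else 0) = w"
      using w by (intro eq_vecI) auto
    ultimately show ?thesis
      using g(2) by metis
  next
    case False
    have "Matrix.vec p (\<lambda>_. 0) = (0\<^sub>v p :: real vec)"
      by (intro eq_vecI) auto
    then have "F (Matrix.vec p g) \<le> F (0\<^sub>v p)"
      using g(2)[OF zero] by simp
    with False show ?thesis by simp
  qed
  then show ?thesis
    using that[of "Matrix.vec p g"] unfolding F_def by simp
qed

lemma lasso_exists:
  assumes "X \<in> carrier_mat n p" "y \<in> carrier_vec n" "lam > 0"
  obtains b where "is_lasso X y lam b"
proof -
  define \<phi> where "\<phi> = (\<lambda>x. x\<^sup>2 / (2 * real n))"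
  have "continuous_on UNIV \<phi>"
    unfolding \<phi>_def divide_inverse by (intro continuous_intros)
  moreover have "0 \<le> \<phi> x" for x
    by (simp add: \<phi>_def)
  ultimately obtain b where "b \<in> carrier_vec p" "\<And>w. w \<in> carrier_vec p \<Longrightarrow>
      \<phi> (l2_norm (y - X *\<^sub>v b)) + lam * l1_norm b \<le> \<phi> (l2_norm (y - X *\<^sub>v w)) + lam * l1_norm w"
    using penalised_minimizer_exists[OF assms] by metis
  then show ?thesis
    using assms by (intro that[of b]) (simp add: is_lasso_def \<phi>_def)
qed

lemma sqrt_lasso_exists:
  assumes "X \<in> carrier_mat n p" "y \<in> carrier_vec n" "lam > 0"
  obtains b where "is_sqrt_lasso X y lam b"
proof -
  \<comment> \<open>The absolute value makes \<open>\<phi>\<close> nonnegative on the whole line; it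
    disappears on norms.\<close>
  define \<phi> where "\<phi> = (\<lambda>x. \<bar>x\<bar> / sqrt (real n))"
  have "continuous_on UNIV \<phi>"
    unfolding \<phi>_def divide_inverse by (intro continuous_intros)
  moreover have "0 \<le> \<phi> x" for x
    by (simp add: \<phi>_def)
  ultimately obtain b where "b \<in> carrier_vec p" "\<And>w. w \<in> carrier_vec p \<Longrightarrow>
      \<phi> (l2_norm (y - X *\<^sub>v b)) + lam * l1_norm b \<le> \<phi> (l2_norm (y - X *\<^sub>v w)) + lam * l1_norm w"
    using penalised_minimizer_exists[OF assms] by metis
  then show ?thesis
    using assms by (intro that[of b]) (simp add: is_sqrt_lasso_def sigma_star_def \<phi>_def)
qed

text \<open>First-order optimality without subgradients: compare \<open>b\<close> with the points at
  fraction \<open>s\<close> of the way to \<open>w\<close>, divide by \<open>s\<close>, and let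
  \<open>s\<close> tend to 0, which removes the quadratic term. Convexity of the l1 norm handles the
  penalty.\<close>

lemma lasso_variational_inequality:
  assumes X: "X \<in> carrier_mat n p" and y: "y \<in> carrier_vec n"
    and lam: "lam \<ge> 0" and b: "is_lasso X y lam b" and w: "w \<in> carrier_vec p"
  shows "lam * (l1_norm b - l1_norm w) \<le> (y - X *\<^sub>v b) \<bullet> (X *\<^sub>v (b - w)) / real n"
proof -
  have bc: "b \<in> carrier_vec p"
    using b X by (auto simp: is_lasso_def)
  define r where "r = y - X *\<^sub>v b"
  define d where "d = X *\<^sub>v (b - w)"
  have rc: "r \<in> carrier_vec n" and dc: "d \<in> carrier_vec n"
    using X y bc w by (auto simp: r_def d_def)
  have step: "lam * (l1_norm b - l1_norm w) \<le> r \<bullet> d / real n + s * ((l2_norm d)\<^sup>2 / (2 * real n))"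
    if s: "0 < s" "s \<le> 1" for s
  proof -
    define v where "v = b - s \<cdot>\<^sub>v (b - w)"
    have vc: "v \<in> carrier_vec p"
      using bc w by (auto simp: v_def)
    have v: "y - X *\<^sub>v v = r - (- s) \<cdot>\<^sub>v d"
    proof -
      have "X *\<^sub>v v = X *\<^sub>v b - s \<cdot>\<^sub>v d"
        unfolding v_def d_def
        using X bc w by (subst mult_minus_distrib_mat_vec[of _ n p]) (auto simp: mult_mat_vec)
      then show ?thesis
        using X y bc dc by (intro eq_vecI) (auto simp: r_def)
    qed
    have l1: "l1_norm v \<le> (1 - s) * l1_norm b + s * l1_norm w"
      unfolding v_def using bc w s by (intro l1_norm_convex) auto
    have "(l2_norm r)\<^sup>2 / (2 * real n) + lam * l1_norm b
        \<le> (l2_norm (r - (- s) \<cdot>\<^sub>v d))\<^sup>2 / (2 * real n) + lam * l1_norm v"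
      using b vc X unfolding is_lasso_def v[symmetric] by (simp add: r_def)
    also have "(l2_norm (r - (- s) \<cdot>\<^sub>v d))\<^sup>2 = (l2_norm r)\<^sup>2 + 2 * s * (r \<bullet> d) + s\<^sup>2 * (l2_norm d)\<^sup>2"
      using rc dc
      by (subst l2_norm_minus_power2[of _ n])
        (auto simp: l2_norm_smult power_mult_distrib scalar_prod_smult_distrib[of _ n])
    also have "lam * l1_norm v \<le> lam * ((1 - s) * l1_norm b + s * l1_norm w)"
      using l1 lam by (rule mult_left_mono)
    finally have "s * (lam * (l1_norm b - l1_norm w)) \<le>
        s * (r \<bullet> d / real n + s * ((l2_norm d)\<^sup>2 / (2 * real n)))"
      by (simp add: add_divide_distrib algebra_simps power2_eq_square)
    then show ?thesis
      using s by simp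
  qed
  have "((\<lambda>s. r \<bullet> d / real n + s * ((l2_norm d)\<^sup>2 / (2 * real n))) \<longlongrightarrow>
      r \<bullet> d / real n + 0 * ((l2_norm d)\<^sup>2 / (2 * real n))) (at_right 0)"
    by (intro tendsto_intros)
  moreover have "eventually (\<lambda>s. lam * (l1_norm b - l1_norm w) \<le>
      r \<bullet> d / real n + s * ((l2_norm d)\<^sup>2 / (2 * real n))) (at_right 0)"
    using step by (intro eventually_at_rightI[of 0 1]) auto
  ultimately show ?thesis
    unfolding r_def d_def by (intro tendsto_lowerbound) auto
qed

subsection \<open>The compatibility factor and the complexity measure\<close>

text \<open>An infimum over the empty set of reals is unspecified, so bounding the compatibility
  factor from below needs a member: a unit vector with its coordinate in \<open>T\<close>.\<close>

lemma compat_factor_set_nonempty: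
  assumes T: "T \<subseteq> {..<p}" "T \<noteq> {}" and \<xi>: "\<xi> > 0"
  shows "\<exists>u. u \<in> cone p \<xi> T \<and> u \<noteq> 0\<^sub>v p"
proof -
  obtain j where j: "j \<in> T" "j < p"
    using T by blast
  have "l1_norm_on ({..<p} - T) (unit_vec p j) = 0"
    using j by (auto simp: l1_norm_on_def intro!: sum.neutral)
  then have "unit_vec p j \<in> cone p \<xi> T"
    using \<xi> by (simp add: cone_def)
  moreover have "unit_vec p j \<noteq> (0\<^sub>v p :: real vec)"
    using j by (metis index_unit_vec(1) index_zero_vec(1) zero_neq_one)
  ultimately show ?thesis by blast
qed

lemma compat_factor_nonneg:
  assumes "X \<in> carrier_mat n p" "T \<subseteq> {..<p}" "T \<noteq> {}" "\<xi> > 0"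
  shows "0 \<le> compat_factor X \<xi> T"
  unfolding compat_factor_def
  using compat_factor_set_nonempty[OF assms(2-4)] assms(1) by (intro cInf_greatest) auto

text \<open>Clearing the denominator gives a form that also covers vectors vanishing on
  \<open>T\<close> and \<open>n = 0\<close>, where the quotient carries no information.\<close>

lemma compat_factor_mult_le:
  assumes X: "X \<in> carrier_mat n p" and T: "T \<subseteq> {..<p}" and u: "u \<in> cone p \<xi> T"
  shows "compat_factor X \<xi> T * (sqrt (real n) * l1_norm_on T u) \<le> sqrt (real (card T)) * l2_norm (X *\<^sub>v u)"
proof (cases "sqrt (real n) * l1_norm_on T u = 0")
  case True
  then have "compat_factor X \<xi> T * (sqrt (real n) * l1_norm_on T u) = 0"
    by (simp only: mult_zero_right)
  then show ?thesis
    by (rule order_trans[OF eq_refl]) simp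
next
  case False
  moreover have "0 \<le> sqrt (real n) * l1_norm_on T u"
    by simp
  ultimately have pos: "0 < sqrt (real n) * l1_norm_on T u"
    by linarith
  have "u \<noteq> 0\<^sub>v p"
    using False l1_norm_on_zero[OF T] by auto
  then have "compat_factor X \<xi> T \<le> sqrt (real (card T)) * l2_norm (X *\<^sub>v u) / (sqrt (real n) * l1_norm_on T u)"
    unfolding compat_factor_def
    using X u by (intro cInf_lower) (auto intro!: bdd_belowI[of _ 0])
  then show ?thesis
    using pos by (simp add: pos_le_divide_eq)
qed

text \<open>The finite values of \<open>eta\<close>. For nonempty \<open>T\<close> with
  compatibility factor 0, division by zero makes the last term 0 instead of infinite; hence the
  admissibility condition \<open>T = {} \<or> compat_factor X \<xi> T \<noteq> 0\<close> wherever
  this is compared with \<open>eta_star\<close>.\<close>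

definition eta_real ::
    "real mat \<Rightarrow> real vec \<Rightarrow> real \<Rightarrow> real \<Rightarrow> real vec \<Rightarrow> nat set \<Rightarrow> real" where
  "eta_real X \<beta>s lam \<xi> w T =
     (l2_norm (X *\<^sub>v \<beta>s - X *\<^sub>v w))\<^sup>2 / real (dim_row X)
     + (if w = \<beta>s \<and> T = {} then 1 else 2) * (2 * lam * l1_norm_on ({..<dim_col X} - T) w)
     + (if T = {} then 0
        else 4 * \<xi>\<^sup>2 * lam\<^sup>2 * real (card T) / ((\<xi> + 1)\<^sup>2 * (compat_factor X \<xi> T)\<^sup>2))"

lemma eta_eq_eta_real:
  "eta X \<beta>s lam \<xi> w T =
     (if T = {} \<or> compat_factor X \<xi> T \<noteq> 0 then ereal (eta_real X \<beta>s lam \<xi> w T) else \<infinity>)"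
  by (simp add: eta_def eta_real_def Let_def)

lemma eta_real_nonneg: "0 \<le> lam \<Longrightarrow> 0 \<le> eta_real X \<beta>s lam \<xi> w T"
  by (simp add: eta_real_def)

text \<open>The infimum is nonnegative, and finite at the pair of the zero vector and the empty set,
  so the conversion to a real loses nothing.\<close>

lemma ereal_eta_star:
  assumes "0 \<le> lam"
  shows "ereal (eta_star X \<beta>s lam \<xi>) =
    (INF w\<in>carrier_vec (dim_col X). INF T\<in>Pow {..<dim_col X}. eta X \<beta>s lam \<xi> w T)" (is "_ = ?I")
proof -
  have "0 \<le> ?I"
    using assms by (intro INF_greatest) (simp add: eta_eq_eta_real eta_real_nonneg)
  moreover have "?I \<le> eta X \<beta>s lam \<xi> (0\<^sub>v (dim_col X)) {}"
    by (intro INF_lower2[of "0\<^sub>v (dim_col X)"] INF_lower) auto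
  then have "?I \<noteq> \<infinity>"
    by (auto simp: eta_eq_eta_real)
  ultimately show ?thesis
    unfolding eta_star_def by (intro ereal_real') auto
qed

lemma eta_star_le:
  assumes "0 \<le> lam" "w \<in> carrier_vec (dim_col X)" "T \<subseteq> {..<dim_col X}"
    "T = {} \<or> compat_factor X \<xi> T \<noteq> 0"
  shows "eta_star X \<beta>s lam \<xi> \<le> eta_real X \<beta>s lam \<xi> w T"
proof -
  have "ereal (eta_star X \<beta>s lam \<xi>) \<le> eta X \<beta>s lam \<xi> w T"
    unfolding ereal_eta_star[OF assms(1)] using assms by (intro INF_lower2[of w] INF_lower) auto
  then show ?thesis
    using assms by (simp add: eta_eq_eta_real)
qed

lemma eta_star_greatest:
  assumes "0 \<le> lam"
    and "\<And>w T. w \<in> carrier_vec (dim_col X) \<Longrightarrow> T \<subseteq> {..<dim_col X} \<Longrightarrow>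
      T = {} \<or> compat_factor X \<xi> T \<noteq> 0 \<Longrightarrow> r \<le> eta_real X \<beta>s lam \<xi> w T"
  shows "r \<le> eta_star X \<beta>s lam \<xi>"
proof -
  have "ereal r \<le> ereal (eta_star X \<beta>s lam \<xi>)"
    unfolding ereal_eta_star[OF assms(1)]
    using assms(2) by (intro INF_greatest) (auto simp: eta_eq_eta_real)
  then show ?thesis by simp
qed

lemma eta_star_nonneg: "0 \<le> lam \<Longrightarrow> 0 \<le> eta_star X \<beta>s lam \<xi>"
  by (intro eta_star_greatest eta_real_nonneg)

section \<open>Dependence of the complexity measure on the penalty level\<close>

lemma eta_real_mono:
  assumes "0 \<le> lam" "lam \<le> lam'"
  shows "eta_real X \<beta>s lam \<xi> w T \<le> eta_real X \<beta>s lam' \<xi> w T"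
  unfolding eta_real_def
  using assms by (auto intro!: add_mono mult_mono mult_left_mono mult_right_mono divide_right_mono power_mono)

text \<open>The three nonnegative terms are homogeneous in \<open>lam\<close> of degrees 0, 1 and 2,
  and for \<open>c \<ge> 1\<close> each factor is at most \<open>c\<^sup>2\<close>.\<close>

lemma eta_real_scale:
  assumes "0 \<le> lam" "1 \<le> c"
  shows "eta_real X \<beta>s (c * lam) \<xi> w T \<le> c\<^sup>2 * eta_real X \<beta>s lam \<xi> w T"
proof -
  have c: "1 \<le> c\<^sup>2" "c \<le> c\<^sup>2"
    using assms by (auto simp: self_le_power)
  define a where "a = (l2_norm (X *\<^sub>v \<beta>s - X *\<^sub>v w))\<^sup>2 / real (dim_row X)"
  define d where "d = (if w = \<beta>s \<and> T = {} then 1 else 2) * (2 * lam * l1_norm_on ({..<dim_col X} - T) w)"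
  define k where "k = (if T = {} then 0
        else 4 * \<xi>\<^sup>2 * lam\<^sup>2 * real (card T) / ((\<xi> + 1)\<^sup>2 * (compat_factor X \<xi> T)\<^sup>2))"
  have "0 \<le> a" "0 \<le> d"
    using assms by (auto simp: a_def d_def)
  then have "a + c * d + c\<^sup>2 * k \<le> c\<^sup>2 * a + c\<^sup>2 * d + c\<^sup>2 * k"
    using c mult_right_mono[of 1 "c\<^sup>2" a] mult_right_mono[of c "c\<^sup>2" d] by simp
  moreover have "eta_real X \<beta>s (c * lam) \<xi> w T = a + c * d + c\<^sup>2 * k"
    by (simp add: eta_real_def a_def d_def k_def power_mult_distrib mult_ac)
  moreover have "eta_real X \<beta>s lam \<xi> w T = a + d + k"
    by (simp add: eta_real_def a_def d_def k_def)
  ultimately show ?thesis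
    by (simp add: algebra_simps)
qed

lemma eta_star_mono:
  assumes "0 \<le> lam" "lam \<le> lam'"
  shows "eta_star X \<beta>s lam \<xi> \<le> eta_star X \<beta>s lam' \<xi>"
  using assms by (intro eta_star_greatest order_trans[OF eta_star_le eta_real_mono]) auto

lemma eta_star_scale:
  assumes "0 \<le> lam" "1 \<le> c"
  shows "eta_star X \<beta>s (c * lam) \<xi> \<le> c\<^sup>2 * eta_star X \<beta>s lam \<xi>"
proof -
  have "eta_star X \<beta>s (c * lam) \<xi> / c\<^sup>2 \<le> eta_star X \<beta>s lam \<xi>"
  proof (rule eta_star_greatest[OF assms(1)])
    fix w :: "real vec" and T assume "w \<in> carrier_vec (dim_col X)" "T \<subseteq> {..<dim_col X}"
      "T = {} \<or> compat_factor X \<xi> T \<noteq> 0"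
    then have "eta_star X \<beta>s (c * lam) \<xi> \<le> eta_real X \<beta>s (c * lam) \<xi> w T"
      using assms by (intro eta_star_le) auto
    also have "\<dots> \<le> c\<^sup>2 * eta_real X \<beta>s lam \<xi> w T"
      by (rule eta_real_scale[OF assms])
    finally show "eta_star X \<beta>s (c * lam) \<xi> / c\<^sup>2 \<le> eta_real X \<beta>s lam \<xi> w T"
      using assms by (simp add: divide_le_eq mult.commute)
  qed
  then show ?thesis
    using assms by (simp add: divide_le_eq mult.commute)
qed

subsection \<open>The oracle inequality for the lasso\<close>

text \<open>The variational inequality tested at \<open>w\<close>, with the inner product of the two
  fit differences rewritten by polarization. The second square on the left is kept: it later absorbs
  the compatibility term.\<close>

lemma lasso_prediction_inequality:
  assumes X: "X \<in> carrier_mat n p" and y: "y \<in> carrier_vec n" and \<beta>s: "\<beta>s \<in> carrier_vec p"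
    and lam: "lam \<ge> 0" and b: "is_lasso X y lam b" and w: "w \<in> carrier_vec p"
    and \<zeta>: "linf_norm ((1 / real n) \<cdot>\<^sub>v (X\<^sup>T *\<^sub>v (y - X *\<^sub>v \<beta>s))) \<le> \<zeta>"
  shows "(l2_norm (X *\<^sub>v b - X *\<^sub>v \<beta>s))\<^sup>2 / real n + (l2_norm (X *\<^sub>v (b - w)))\<^sup>2 / real n
    \<le> (l2_norm (X *\<^sub>v \<beta>s - X *\<^sub>v w))\<^sup>2 / real n + 2 * \<zeta> * l1_norm (b - w)
      + 2 * lam * (l1_norm w - l1_norm b)"
proof -
  have bc: "b \<in> carrier_vec p"
    using b X by (auto simp: is_lasso_def)
  define e where "e = y - X *\<^sub>v \<beta>s"
  define h where "h = X *\<^sub>v b - X *\<^sub>v \<beta>s"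
  define d where "d = X *\<^sub>v (b - w)"
  have c: "e \<in> carrier_vec n" "h \<in> carrier_vec n" "d \<in> carrier_vec n"
    using X y \<beta>s bc w by (auto simp: e_def h_def d_def)
  have "y - X *\<^sub>v b = e - h"
    using X y \<beta>s bc by (intro eq_vecI) (auto simp: e_def h_def)
  then have "lam * (l1_norm b - l1_norm w) \<le> (e - h) \<bullet> d / real n"
    using lasso_variational_inequality[OF X y lam b w] by (simp add: d_def)
  also have "\<dots> = e \<bullet> d / real n - h \<bullet> d / real n"
    using c by (simp add: minus_scalar_prod_distrib[of _ n] diff_divide_distrib)
  also have "e \<bullet> d / real n \<le> \<zeta> * l1_norm (b - w)"
    using scalar_prod_mat_mult_le[OF X c(1), of "b - w"] mult_right_mono[OF \<zeta>, of "l1_norm (b - w)"] bc w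
    by (simp add: d_def e_def)
  finally have 1: "lam * (l1_norm b - l1_norm w) \<le> \<zeta> * l1_norm (b - w) - h \<bullet> d / real n"
    by simp
  have "X *\<^sub>v \<beta>s - X *\<^sub>v w = d - h"
    using X \<beta>s bc w unfolding d_def h_def
    by (subst mult_minus_distrib_mat_vec[of _ n p]) (auto intro!: eq_vecI)
  then have "(l2_norm (X *\<^sub>v \<beta>s - X *\<^sub>v w))\<^sup>2 = (l2_norm d)\<^sup>2 - 2 * (h \<bullet> d) + (l2_norm h)\<^sup>2"
    using c l2_norm_minus_power2[of d n h] comm_scalar_prod[of h n d] by simp
  then have "(l2_norm (X *\<^sub>v \<beta>s - X *\<^sub>v w))\<^sup>2 / real n =
      (l2_norm d)\<^sup>2 / real n - 2 * (h \<bullet> d / real n) + (l2_norm h)\<^sup>2 / real n"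
    by (simp add: add_divide_distrib diff_divide_distrib)
  moreover have "2 * (lam * (l1_norm b - l1_norm w)) \<le>
      2 * (\<zeta> * l1_norm (b - w)) - 2 * (h \<bullet> d / real n)"
    using 1 by linarith
  ultimately show ?thesis
    unfolding h_def[symmetric] d_def[symmetric] right_diff_distrib by linarith
qed

text \<open>It suffices to treat one admissible pair \<open>w\<close>, \<open>T\<close>. If the
  error \<open>b - w\<close> lies outside the cone, the l1 terms on the right have the favourable
  sign; inside it, the compatibility factor trades them for the prediction distance to
  \<open>w\<close>.\<close>

lemma lasso_oracle_inequality:
  assumes X: "X \<in> carrier_mat n p" and y: "y \<in> carrier_vec n" and \<beta>s: "\<beta>s \<in> carrier_vec p"
    and n: "n > 0" and lam: "lam \<ge> 0" and \<xi>: "\<xi> > 1" and b: "is_lasso X y lam b"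
    and \<zeta>: "linf_norm ((1 / real n) \<cdot>\<^sub>v (X\<^sup>T *\<^sub>v (y - X *\<^sub>v \<beta>s))) \<le> lam * (\<xi> - 1) / (\<xi> + 1)"
  shows "(l2_norm (X *\<^sub>v b - X *\<^sub>v \<beta>s))\<^sup>2 / real n \<le> eta_star X \<beta>s lam \<xi>"
proof (rule eta_star_greatest[OF lam])
  fix w :: "real vec" and T assume "w \<in> carrier_vec (dim_col X)" and "T \<subseteq> {..<dim_col X}"
    and adm: "T = {} \<or> compat_factor X \<xi> T \<noteq> 0"
  then have w: "w \<in> carrier_vec p" and T: "T \<subseteq> {..<p}"
    using X by auto
  have bc: "b \<in> carrier_vec p"
    using b X by (auto simp: is_lasso_def)
  define \<zeta> where "\<zeta> = lam * (\<xi> - 1) / (\<xi> + 1)"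
  have \<zeta>_nonneg: "0 \<le> \<zeta>"
    using \<xi> lam by (simp add: \<zeta>_def)
  have \<zeta>_lam: "\<zeta> \<le> lam"
    using \<xi> lam by (simp add: \<zeta>_def divide_le_eq mult_left_mono)
  \<comment> \<open>\<open>q\<close> is the penalty minus the noise bound. The penalty plus the
    noise bound is then \<open>q * \<xi>\<close>, so the l1 terms combine into \<open>q\<close>
    times the expression whose sign decides membership in the cone.\<close>
  define q where "q = 2 * lam / (\<xi> + 1)"
  have q: "0 \<le> q"
    using \<xi> lam by (simp add: q_def)
  have plus: "lam + \<zeta> = q * \<xi>" and minus: "lam - \<zeta> = q"
    using \<xi> by (simp_all add: \<zeta>_def q_def field_simps)
  define u where "u = b - w"
  have uc: "u \<in> carrier_vec p"
    using bc w by (simp add: u_def)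
  define H where "H = (l2_norm (X *\<^sub>v b - X *\<^sub>v \<beta>s))\<^sup>2 / real n"
  define D where "D = l2_norm (X *\<^sub>v u) / sqrt (real n)"
  define Fw where "Fw = (l2_norm (X *\<^sub>v \<beta>s - X *\<^sub>v w))\<^sup>2 / real n"
  have main: "H + D\<^sup>2 \<le> Fw + 2 * \<zeta> * l1_norm u + 2 * lam * (l1_norm w - l1_norm b)"
    using lasso_prediction_inequality[OF X y \<beta>s lam b w \<zeta>[folded \<zeta>_def]]
    by (simp add: H_def D_def Fw_def u_def power_divide)
  have "(l2_norm (X *\<^sub>v b - X *\<^sub>v \<beta>s))\<^sup>2 / real n \<le> eta_real X \<beta>s lam \<xi> w T"
  proof (cases "w = \<beta>s \<and> T = {}")
    case True
    \<comment> \<open>In this case \<open>eta\<close> charges \<open>2 * lam\<close> instead of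
      \<open>4 * lam\<close>. The saving comes from the two squares on the left being equal, so that
      the whole inequality can be halved.\<close>
    have "H = D\<^sup>2" "Fw = 0"
      using True X bc \<beta>s
      by (auto simp: H_def D_def Fw_def u_def power_divide mult_minus_distrib_mat_vec[of _ n p] l2_norm_eq_0_iff[of _ n])
    moreover have "\<zeta> * l1_norm u \<le> \<zeta> * (l1_norm b + l1_norm w)"
      using \<zeta>_nonneg l1_norm_minus_le[OF bc w] by (simp add: u_def mult_left_mono)
    ultimately have "H \<le> \<zeta> * (l1_norm b + l1_norm w) + lam * (l1_norm w - l1_norm b)"
      using main by simp
    also have "\<dots> = 2 * lam * l1_norm w - (lam - \<zeta>) * (l1_norm w + l1_norm b)"
      by (simp add: algebra_simps)
    also have "\<dots> \<le> 2 * lam * l1_norm w"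
      using \<zeta>_lam by simp
    finally show ?thesis
      using True X \<beta>s \<open>Fw = 0\<close> l1_norm_split[OF w, of "{}"]
      by (simp add: eta_real_def H_def Fw_def l1_norm_on_def add_increasing)
  next
    case False
    define Tc where "Tc = {..<p} - T"
    have Tc: "Tc \<subseteq> {..<p}"
      by (auto simp: Tc_def)
    have split: "l1_norm v = l1_norm_on T v + l1_norm_on Tc v" if "v \<in> carrier_vec p" for v
      using l1_norm_split[OF that T] by (simp add: Tc_def)
    have "l1_norm_on T w \<le> l1_norm_on T b + l1_norm_on T u"
      by (rule l1_norm_on_le) (use bc w T in \<open>auto simp: u_def\<close>)
    moreover have "l1_norm_on Tc u \<le> l1_norm_on Tc b + l1_norm_on Tc w"
      by (rule l1_norm_on_le) (use bc w Tc in \<open>auto simp: u_def\<close>)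
    ultimately have "l1_norm w - l1_norm b \<le> l1_norm_on T u + 2 * l1_norm_on Tc w - l1_norm_on Tc u"
      using split[OF w] split[OF bc] by linarith
    then have "2 * lam * (l1_norm w - l1_norm b) \<le>
        2 * lam * (l1_norm_on T u + 2 * l1_norm_on Tc w - l1_norm_on Tc u)"
      using lam by (intro mult_left_mono) auto
    then have "H + D\<^sup>2 \<le> Fw + 4 * lam * l1_norm_on Tc w
        + 2 * (lam + \<zeta>) * l1_norm_on T u - 2 * (lam - \<zeta>) * l1_norm_on Tc u"
      using main split[OF uc] by (simp add: algebra_simps)
    also have "\<dots> = Fw + 4 * lam * l1_norm_on Tc w
        + 2 * q * (\<xi> * l1_norm_on T u - l1_norm_on Tc u)"
      unfolding plus minus by (simp add: algebra_simps)
    finally have main': "H + D\<^sup>2 \<le> Fw + 4 * lam * l1_norm_on Tc w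
        + 2 * q * (\<xi> * l1_norm_on T u - l1_norm_on Tc u)" .
    have eta: "eta_real X \<beta>s lam \<xi> w T = Fw + 4 * lam * l1_norm_on Tc w
        + (if T = {} then 0
           else 4 * \<xi>\<^sup>2 * lam\<^sup>2 * real (card T) / ((\<xi> + 1)\<^sup>2 * (compat_factor X \<xi> T)\<^sup>2))"
    proof -
      have "(w = \<beta>s \<and> T = {}) = False"
        using False by blast
      then show ?thesis
        using X unfolding eta_real_def by (simp only: Fw_def Tc_def) simp
    qed
    show ?thesis
    proof (cases "T \<noteq> {} \<and> u \<in> cone p \<xi> T")
      case True
      define \<kappa> where "\<kappa> = compat_factor X \<xi> T"
      \<comment> \<open>Chosen so that the compatibility bound reads \<open>2 * D * m\<close>. Then
        \<open>2 * D * m \<le> D\<^sup>2 + m\<^sup>2\<close> cancels \<open>D\<^sup>2\<close> and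
        leaves \<open>m\<^sup>2\<close>, which is exactly the last term of
        \<open>eta\<close>.\<close>
      define m where "m = q * \<xi> * sqrt (real (card T)) / \<kappa>"
      have \<kappa>: "0 < \<kappa>"
        using compat_factor_nonneg[OF X T, of \<xi>] True adm \<xi> by (simp add: \<kappa>_def)
      have "\<kappa> * l1_norm_on T u \<le> sqrt (real (card T)) * D"
        using compat_factor_mult_le[OF X T, of u \<xi>] True n
        unfolding D_def \<kappa>_def times_divide_eq_right by (subst pos_le_divide_eq) (auto simp: mult_ac)
      then have "l1_norm_on T u \<le> sqrt (real (card T)) * D / \<kappa>"
        using \<kappa> by (subst pos_le_divide_eq) (auto simp: mult.commute)
      then have "2 * q * \<xi> * l1_norm_on T u \<le>
          2 * q * \<xi> * (sqrt (real (card T)) * D / \<kappa>)"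
        using q \<xi> by (intro mult_left_mono) auto
      also have "\<dots> = 2 * (D * m)"
        by (simp add: m_def mult_ac)
      also have "\<dots> \<le> D\<^sup>2 + m\<^sup>2"
        using sum_squares_bound[of D m] by simp
      also have "m\<^sup>2 = 4 * \<xi>\<^sup>2 * lam\<^sup>2 * real (card T) / ((\<xi> + 1)\<^sup>2 * \<kappa>\<^sup>2)"
        by (simp add: m_def q_def power_divide power_mult_distrib mult_ac)
      finally have "2 * q * \<xi> * l1_norm_on T u \<le>
          D\<^sup>2 + 4 * \<xi>\<^sup>2 * lam\<^sup>2 * real (card T) / ((\<xi> + 1)\<^sup>2 * \<kappa>\<^sup>2)" .
      moreover have "2 * q * (\<xi> * l1_norm_on T u - l1_norm_on Tc u)
          \<le> 2 * q * \<xi> * l1_norm_on T u"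
        using q by (simp add: right_diff_distrib)
      ultimately show ?thesis
        using main' True unfolding eta \<kappa>_def H_def by simp
    next
      case False
      have "\<xi> * l1_norm_on T u - l1_norm_on Tc u \<le> 0"
      proof (cases "T = {}")
        case True
        then show ?thesis by (simp add: l1_norm_on_def sum_nonneg)
      next
        case False
        with \<open>\<not> (T \<noteq> {} \<and> u \<in> cone p \<xi> T)\<close> uc show ?thesis
          by (simp add: cone_def Tc_def)
      qed
      then have "2 * q * (\<xi> * l1_norm_on T u - l1_norm_on Tc u) \<le> 0"
        using q by (intro mult_nonneg_nonpos) auto
      then have "H \<le> Fw + 4 * lam * l1_norm_on Tc w"
        using main' zero_le_power2[of D] by linarith
      also have "\<dots> \<le> eta_real X \<beta>s lam \<xi> w T"
        unfolding eta by simp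
      finally show ?thesis
        by (simp add: H_def)
    qed
  qed
  then show "(l2_norm (X *\<^sub>v b - X *\<^sub>v \<beta>s))\<^sup>2 / real n \<le> eta_real X \<beta>s lam \<xi> w T" .
qed

subsection \<open>Noise level estimation by the scaled lasso\<close>

text \<open>By the inequality of arithmetic and geometric means,
  \<open>a\<^sup>2 / (2 * s) + s / 2\<close> has minimum \<open>a\<close>, attained only at
  \<open>s = a\<close>. Positivity stays on the right because a zero residual leaves the infimum
  over \<open>\<sigma> > 0\<close> unattained.\<close>

lemma scaled_lasso_iff_sqrt_lasso:
  assumes X: "X \<in> carrier_mat n p" and n: "n > 0"
  shows "is_scaled_lasso X y lam b \<sigma> \<longleftrightarrow>
    is_sqrt_lasso X y lam b \<and> \<sigma> = sigma_star X y b \<and> \<sigma> > 0"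
proof -
  have obj: "scaled_lasso_objective X y lam (w, s) =
      (sigma_star X y w)\<^sup>2 / (2 * s) + s / 2 + lam * l1_norm w" for w s
    using X by (simp add: scaled_lasso_objective_def sigma_star_power2)
  have amgm: "a \<le> a\<^sup>2 / (2 * s) + s / 2" if "0 < s" for a s :: real
  proof -
    have "a * (2 * s) \<le> a\<^sup>2 + s\<^sup>2"
      using sum_squares_bound[of a s] by simp
    then have "a \<le> (a\<^sup>2 + s\<^sup>2) / (2 * s)"
      using that by (subst pos_le_divide_eq) auto
    then show ?thesis
      using that by (simp add: add_divide_distrib power2_eq_square)
  qed
  show ?thesis
  proof
    assume *: "is_scaled_lasso X y lam b \<sigma>"
    then have b: "b \<in> carrier_vec p" and pos: "\<sigma> > 0"
      using X by (auto simp: is_scaled_lasso_def is_arg_min_def)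
    have min: "(sigma_star X y b)\<^sup>2 / (2 * \<sigma>) + \<sigma> / 2 + lam * l1_norm b
        \<le> (sigma_star X y w)\<^sup>2 / (2 * s) + s / 2 + lam * l1_norm w"
      if "w \<in> carrier_vec p" "s > 0" for w s
      using * that X unfolding is_scaled_lasso_def is_arg_min_def obj[symmetric]
      by (auto simp: not_less) (meson not_le)
    \<comment> \<open>With zero residual, halving \<open>\<sigma>\<close> would lower the
      objective.\<close>
    have "sigma_star X y b \<noteq> 0"
      using min[OF b, of "\<sigma> / 2"] pos by auto
    then have s_pos: "0 < sigma_star X y b"
      using sigma_star_nonneg[of X y b] by linarith
    define s where "s = sigma_star X y b"
    have "s\<^sup>2 / (2 * \<sigma>) + \<sigma> / 2 \<le> s"
      using min[OF b s_pos] s_pos by (simp add: s_def power2_eq_square)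
    then have "(s\<^sup>2 / (2 * \<sigma>) + \<sigma> / 2) * (2 * \<sigma>) \<le> s * (2 * \<sigma>)"
      using pos by (intro mult_right_mono) auto
    then have "(s - \<sigma>)\<^sup>2 \<le> 0"
      using pos by (simp add: power2_eq_square algebra_simps)
    then have eq: "\<sigma> = sigma_star X y b"
      by (simp add: s_def)
    \<comment> \<open>The residual level \<open>a\<close> of \<open>w\<close> may be 0, which is not
      an admissible noise level; hence \<open>a + e\<close> is used and \<open>e\<close> is let go
      to 0.\<close>
    have "sigma_star X y b + lam * l1_norm b \<le> sigma_star X y w + lam * l1_norm w"
      if w: "w \<in> carrier_vec p" for w
    proof (rule field_le_epsilon)
      fix e :: real assume e: "0 < e"
      define a where "a = sigma_star X y w"
      have a: "0 \<le> a"
        by (simp add: a_def sigma_star_nonneg)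
      have "a\<^sup>2 / (2 * (a + e)) \<le> a / 2"
        using a e by (subst pos_divide_le_eq) (auto simp: power2_eq_square algebra_simps)
      moreover have "s + lam * l1_norm b \<le> a\<^sup>2 / (2 * (a + e)) + (a + e) / 2 + lam * l1_norm w"
        using min[OF w, of "a + e"] amgm[OF pos, of s] a e by (simp add: a_def s_def)
      ultimately show "sigma_star X y b + lam * l1_norm b \<le> sigma_star X y w + lam * l1_norm w + e"
        unfolding a_def[symmetric] s_def[symmetric] using e by argo
    qed
    then show "is_sqrt_lasso X y lam b \<and> \<sigma> = sigma_star X y b \<and> \<sigma> > 0"
      using X b eq pos by (simp add: is_sqrt_lasso_def)
  next
    assume *: "is_sqrt_lasso X y lam b \<and> \<sigma> = sigma_star X y b \<and> \<sigma> > 0"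
    have "(sigma_star X y b)\<^sup>2 / (2 * \<sigma>) + \<sigma> / 2 + lam * l1_norm b
        \<le> (sigma_star X y w)\<^sup>2 / (2 * s) + s / 2 + lam * l1_norm w"
      if "w \<in> carrier_vec p" "s > 0" for w s
    proof -
      have "(sigma_star X y b)\<^sup>2 / (2 * \<sigma>) + \<sigma> / 2 = sigma_star X y b"
        using * by (simp add: power2_eq_square)
      moreover have "sigma_star X y b + lam * l1_norm b \<le> sigma_star X y w + lam * l1_norm w"
        using * X that by (simp add: is_sqrt_lasso_def)
      ultimately show ?thesis
        using amgm[OF that(2), of "sigma_star X y w"] by linarith
    qed
    then show "is_scaled_lasso X y lam b \<sigma>"
      using * X unfolding is_scaled_lasso_def is_arg_min_def
      by (auto simp: obj not_less is_sqrt_lasso_def) (meson not_le)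
  qed
qed

text \<open>Multiplying the square-root objective by the residual level s of \<open>b\<close>
  replaces the parabola \<open>a\<^sup>2 / 2\<close> by its tangent at s, up to a constant. The
  parabola lies above the tangent and touches it at \<open>b\<close>.\<close>

lemma sqrt_lasso_imp_lasso:
  assumes "X \<in> carrier_mat n p" "is_sqrt_lasso X y lam b" "sigma_star X y b > 0"
  shows "is_lasso X y (sigma_star X y b * lam) b"
proof -
  define s where "s = sigma_star X y b"
  have s: "s > 0"
    using assms by (simp add: s_def)
  have sq: "(l2_norm (y - X *\<^sub>v w))\<^sup>2 / (2 * real (dim_row X)) = (sigma_star X y w)\<^sup>2 / 2" for w
    by (simp add: sigma_star_power2)
  have "s\<^sup>2 / 2 + s * lam * l1_norm b \<le> (sigma_star X y w)\<^sup>2 / 2 + s * lam * l1_norm w"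
    if "w \<in> carrier_vec (dim_col X)" for w
  proof -
    have "s * (s + lam * l1_norm b) \<le> s * (sigma_star X y w + lam * l1_norm w)"
      using assms(2) that s by (intro mult_left_mono) (auto simp: is_sqrt_lasso_def s_def)
    moreover have "2 * s * sigma_star X y w \<le> s\<^sup>2 + (sigma_star X y w)\<^sup>2"
      by (rule sum_squares_bound)
    ultimately show ?thesis
      by (simp add: power2_eq_square algebra_simps)
  qed
  then show ?thesis
    using assms(2) unfolding is_lasso_def sq s_def[symmetric]
    by (simp add: is_sqrt_lasso_def)
qed

section \<open>Residual level and prediction error of the square-root lasso\<close>

lemma sigma_star_diff_le:
  assumes "X \<in> carrier_mat n p" "y \<in> carrier_vec n" "\<beta>s \<in> carrier_vec p" "b \<in> carrier_vec p"
  shows "\<bar>sigma_star X y b - sigma_star X y \<beta>s\<bar> \<le> l2_norm (X *\<^sub>v b - X *\<^sub>v \<beta>s) / sqrt (real n)"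
proof -
  have 1: "y - X *\<^sub>v \<beta>s - (X *\<^sub>v b - X *\<^sub>v \<beta>s) = y - X *\<^sub>v b"
    and 2: "y - X *\<^sub>v b - (X *\<^sub>v \<beta>s - X *\<^sub>v b) = y - X *\<^sub>v \<beta>s"
    using assms by (auto intro!: eq_vecI)
  have "l2_norm (y - X *\<^sub>v \<beta>s) \<le> l2_norm (y - X *\<^sub>v b) + l2_norm (X *\<^sub>v b - X *\<^sub>v \<beta>s)"
    using assms l2_norm_triangle_minus[of "y - X *\<^sub>v \<beta>s" n "X *\<^sub>v b - X *\<^sub>v \<beta>s"] by (simp add: 1)
  moreover have "l2_norm (y - X *\<^sub>v b) \<le> l2_norm (y - X *\<^sub>v \<beta>s) + l2_norm (X *\<^sub>v b - X *\<^sub>v \<beta>s)"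
    using assms l2_norm_triangle_minus[of "y - X *\<^sub>v b" n "X *\<^sub>v \<beta>s - X *\<^sub>v b"]
      l2_norm_minus_commute[of "X *\<^sub>v \<beta>s" n "X *\<^sub>v b"] by (simp add: 2)
  ultimately have "\<bar>l2_norm (y - X *\<^sub>v b) - l2_norm (y - X *\<^sub>v \<beta>s)\<bar> \<le> l2_norm (X *\<^sub>v b - X *\<^sub>v \<beta>s)"
    by linarith
  then have "\<bar>l2_norm (y - X *\<^sub>v b) - l2_norm (y - X *\<^sub>v \<beta>s)\<bar> / sqrt (real n)
      \<le> l2_norm (X *\<^sub>v b - X *\<^sub>v \<beta>s) / sqrt (real n)"
    by (rule divide_right_mono) simp
  then show ?thesis
    using assms by (simp add: sigma_star_def flip: diff_divide_distrib)
qed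

text \<open>This is Cauchy-Schwarz for \<open>a\<close> and \<open>a - g\<close>, obtained by
  squaring the triangle inequality. With \<open>a\<close> a residual and \<open>g\<close> a change
  of the fit, a drop in the residual norm forces a large pairing.\<close>

lemma scalar_prod_ge_of_norm_drop:
  assumes a: "a \<in> carrier_vec n" and g: "g \<in> carrier_vec n"
    and le: "l2_norm (a - g) \<le> l2_norm a"
  shows "l2_norm a * (l2_norm a - l2_norm (a - g)) \<le> a \<bullet> g"
proof -
  have "l2_norm a - l2_norm (a - g) \<le> l2_norm g"
    using l2_norm_triangle_minus[OF a g] by simp
  then have "(l2_norm a - l2_norm (a - g))\<^sup>2 \<le> (l2_norm g)\<^sup>2"
    using le by (intro power_mono) auto
  then show ?thesis
    using l2_norm_minus_power2[OF a g] by (simp add: power2_eq_square algebra_simps)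
qed

text \<open>The equality case of the triangle inequality for \<open>e = r + (e - r)\<close>:
  expanding the squared distance from \<open>r\<close> to
  \<open>(1 - \<tau>) \<cdot>\<^sub>v e\<close> shows that it is at most 0.\<close>

lemma eq_smult_of_norm_split:
  assumes e: "e \<in> carrier_vec n" and r: "r \<in> carrier_vec n" and \<tau>: "\<tau> \<le> 1"
    and 1: "l2_norm r = (1 - \<tau>) * l2_norm e" and 2: "l2_norm (e - r) \<le> \<tau> * l2_norm e"
  shows "r = (1 - \<tau>) \<cdot>\<^sub>v e"
proof -
  have "(l2_norm (e - r))\<^sup>2 \<le> (\<tau> * l2_norm e)\<^sup>2"
    using 2 by (intro power_mono) auto
  moreover have "(l2_norm (e - r))\<^sup>2 = (l2_norm e)\<^sup>2 - 2 * (r \<bullet> e) + (l2_norm r)\<^sup>2"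
    using l2_norm_minus_power2[OF e r] comm_scalar_prod[OF e r] by simp
  ultimately have "(1 - \<tau>) * (l2_norm e)\<^sup>2 \<le> r \<bullet> e"
    unfolding 1 by (simp add: power2_eq_square algebra_simps)
  then have "(1 - \<tau>) * ((1 - \<tau>) * (l2_norm e)\<^sup>2) \<le> (1 - \<tau>) * (r \<bullet> e)"
    using \<tau> by (intro mult_left_mono) auto
  moreover have "(l2_norm (r - (1 - \<tau>) \<cdot>\<^sub>v e))\<^sup>2 =
      (l2_norm r)\<^sup>2 - 2 * ((1 - \<tau>) * (r \<bullet> e)) + ((1 - \<tau>) * l2_norm e)\<^sup>2"
    using e r \<tau> by (subst l2_norm_minus_power2[of _ n])
      (auto simp: l2_norm_smult scalar_prod_smult_distrib[of _ n])
  ultimately have "(l2_norm (r - (1 - \<tau>) \<cdot>\<^sub>v e))\<^sup>2 \<le> 0"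
    unfolding 1 by (simp add: power2_eq_square algebra_simps)
  then have "r - (1 - \<tau>) \<cdot>\<^sub>v e = 0\<^sub>v n"
    using e r l2_norm_eq_0_iff[of "r - (1 - \<tau>) \<cdot>\<^sub>v e" n] by simp
  then have "(r - (1 - \<tau>) \<cdot>\<^sub>v e) $ i = 0" if "i < n" for i
    using that by simp
  then show ?thesis
    using e r by (intro eq_vecI) auto
qed

text \<open>No solution is assumed to exist, so that existence can be derived in the same context.
  The case \<open>\<tau> = 1\<close>, in which the bounds become trivial, is kept outside.\<close>

locale scaled_lasso_setup =
  fixes X :: "real mat" and y \<beta>s :: "real vec" and n p :: nat and lam0 \<xi> \<sigma>s \<tau> :: real
  defines "\<sigma>s \<equiv> sigma_star X y \<beta>s" and "\<tau> \<equiv> tau0 X y \<beta>s lam0 \<xi>"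
  assumes X: "X \<in> carrier_mat n p" and y: "y \<in> carrier_vec n" and \<beta>s: "\<beta>s \<in> carrier_vec p"
    and lam0: "lam0 > 0" and \<xi>: "\<xi> > 1" and \<sigma>s: "\<sigma>s > 0" and \<tau>: "\<tau> < 1"
    and z: "z_star X y \<beta>s \<le> (1 - \<tau>) * lam0 * (\<xi> - 1) / (\<xi> + 1)"
begin

text \<open>For \<open>n = 0\<close> the division in \<open>sigma_star\<close> returns 0.\<close>

lemma n_pos: "n > 0"
  using \<sigma>s X unfolding \<sigma>s_def sigma_star_def by (cases n) auto

lemma \<tau>_nonneg: "0 \<le> \<tau>"
  using \<sigma>s lam0 unfolding \<tau>_def \<sigma>s_def tau0_def by (simp add: eta_star_nonneg)

lemma eta_star_\<sigma>s: "eta_star X \<beta>s (\<sigma>s * lam0) \<xi> = (\<tau> * \<sigma>s)\<^sup>2"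
  using \<sigma>s lam0 unfolding \<tau>_def \<sigma>s_def tau0_def by (simp add: eta_star_nonneg)

abbreviation "\<zeta> \<equiv> linf_norm ((1 / real n) \<cdot>\<^sub>v (X\<^sup>T *\<^sub>v (y - X *\<^sub>v \<beta>s)))"

text \<open>This is the noise condition of the oracle inequality at level \<open>s * lam0\<close>,
  available from the threshold \<open>(1 - \<tau>) * \<sigma>s\<close> upwards.\<close>

lemma \<zeta>_le:
  assumes "(1 - \<tau>) * \<sigma>s \<le> s"
  shows "\<zeta> \<le> s * lam0 * (\<xi> - 1) / (\<xi> + 1)"
proof -
  have "\<zeta> / \<sigma>s \<le> (1 - \<tau>) * (lam0 * (\<xi> - 1) / (\<xi> + 1))"
    using z X unfolding z_star_def \<sigma>s_def by (simp add: mult_ac)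
  then have "\<zeta> \<le> ((1 - \<tau>) * \<sigma>s) * (lam0 * (\<xi> - 1) / (\<xi> + 1))"
    using \<sigma>s by (simp add: pos_divide_le_eq mult_ac)
  also have "\<dots> \<le> s * (lam0 * (\<xi> - 1) / (\<xi> + 1))"
    using assms lam0 \<xi> by (intro mult_right_mono) auto
  finally show ?thesis by (simp add: mult_ac)
qed

lemma prediction_le:
  assumes "(1 - \<tau>) * \<sigma>s \<le> s" "is_lasso X y (s * lam0) b"
  shows "l2_norm (X *\<^sub>v b - X *\<^sub>v \<beta>s) / sqrt (real n) \<le> sqrt (eta_star X \<beta>s (s * lam0) \<xi>)"
proof -
  have "0 \<le> (1 - \<tau>) * \<sigma>s"
    using \<tau> \<sigma>s by simp
  then have "0 \<le> s * lam0"
    using assms(1) lam0 by simp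
  then have "(l2_norm (X *\<^sub>v b - X *\<^sub>v \<beta>s) / sqrt (real n))\<^sup>2 \<le> eta_star X \<beta>s (s * lam0) \<xi>"
    using lasso_oracle_inequality[OF X y \<beta>s n_pos _ \<xi> assms(2) \<zeta>_le[OF assms(1)]]
    by (simp add: power_divide)
  then show ?thesis
    by (rule real_le_rsqrt)
qed

text \<open>The square-root lasso \<open>b\<close> is compared with the lasso \<open>b'\<close> at level \<open>(1 - \<tau>) \<sigma>\<^sup>* \<lambda>\<^sub>0\<close>.
  Unless its residual level already is at least \<open>(1 - \<tau>) \<sigma>\<^sup>*\<close>, all inequalities are sharp, the residual
  of \<open>b'\<close> is a multiple of the noise, and the strict inequality \<open>z\<^sup>* < \<lambda>\<^sub>0\<close> forces \<open>b' = 0\<close> and then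
  \<open>b = 0\<close>, so that the residual levels coincide after all.\<close>

lemma sqrt_lasso_lower_bound:
  assumes b: "is_sqrt_lasso X y lam0 b"
  shows "(1 - \<tau>) * \<sigma>s \<le> sigma_star X y b"
proof (rule ccontr)
  define t where "t = (1 - \<tau>) * \<sigma>s"
  define lam where "lam = t * lam0"
  define s where "s = sigma_star X y b"
  assume "\<not> ?thesis"
  then have st: "s < t"
    by (simp add: s_def t_def)
  have bc: "b \<in> carrier_vec p"
    using b X by (simp add: is_sqrt_lasso_def)
  have t: "0 < t"
    using \<tau> \<sigma>s by (simp add: t_def)
  have lam: "0 < lam"
    using t lam0 by (simp add: lam_def)
  obtain b' where b': "is_lasso X y lam b'"
    using lasso_exists[OF X y lam] .
  then have b'c: "b' \<in> carrier_vec p"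
    using X by (simp add: is_lasso_def)
  define s' where "s' = sigma_star X y b'"
  define e where "e = y - X *\<^sub>v \<beta>s"
  define r where "r = y - X *\<^sub>v b'"
  define g where "g = X *\<^sub>v (b - b')"
  have c: "e \<in> carrier_vec n" "r \<in> carrier_vec n" "g \<in> carrier_vec n"
    using X y \<beta>s bc b'c by (auto simp: e_def r_def g_def)
  have rn: "l2_norm r = s' * sqrt (real n)" and en: "l2_norm e = \<sigma>s * sqrt (real n)"
    using n_pos X by (auto simp: r_def e_def s'_def \<sigma>s_def sigma_star_def)
  have rg: "r - g = y - X *\<^sub>v b"
    using X y bc b'c unfolding r_def g_def
    by (subst mult_minus_distrib_mat_vec[of _ n p]) (auto intro!: eq_vecI)
  have rgn: "l2_norm (r - g) = s * sqrt (real n)"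
    using n_pos X unfolding rg by (auto simp: s_def sigma_star_def)
  have "lam \<le> \<sigma>s * lam0"
    using \<tau>_nonneg \<sigma>s lam0 by (simp add: lam_def t_def)
  have "l2_norm (X *\<^sub>v b' - X *\<^sub>v \<beta>s) / sqrt (real n) \<le> sqrt (eta_star X \<beta>s lam \<xi>)"
    using prediction_le[of t b'] b' by (simp add: t_def lam_def)
  also have "\<dots> \<le> sqrt (eta_star X \<beta>s (\<sigma>s * lam0) \<xi>)"
    using lam \<open>lam \<le> \<sigma>s * lam0\<close> by (intro real_sqrt_le_mono eta_star_mono) auto
  also have "\<dots> = \<tau> * \<sigma>s"
    using \<tau>_nonneg \<sigma>s unfolding eta_star_\<sigma>s by simp
  finally have h: "l2_norm (X *\<^sub>v b' - X *\<^sub>v \<beta>s) / sqrt (real n) \<le> \<tau> * \<sigma>s" .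
  then have ts': "t \<le> s'"
    using sigma_star_diff_le[OF X y \<beta>s b'c] by (simp add: t_def s'_def \<sigma>s_def algebra_simps)
  have gap: "s' * (s' - s) \<le> r \<bullet> g / real n"
  proof -
    have "s' * sqrt (real n) * (s' * sqrt (real n) - s * sqrt (real n)) \<le> r \<bullet> g"
      using scalar_prod_ge_of_norm_drop[OF c(2,3)] ts' st by (simp add: rn rgn mult_right_mono)
    also have "s' * sqrt (real n) * (s' * sqrt (real n) - s * sqrt (real n)) = s' * (s' - s) * real n"
      by (simp add: algebra_simps)
    finally show ?thesis
      using n_pos by (simp add: pos_le_divide_eq)
  qed
  have pen: "lam0 * (l1_norm b - l1_norm b') \<le> s' - s"
    using b b'c X by (simp add: is_sqrt_lasso_def s_def s'_def algebra_simps)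
  \<comment> \<open>Optimality of \<open>b'\<close> tested against \<open>b\<close> bounds from
    above the pairing that \<open>gap\<close> bounds from below.\<close>
  have "lam * (l1_norm b' - l1_norm b) \<le> r \<bullet> (X *\<^sub>v (b' - b)) / real n"
    using lasso_variational_inequality[OF X y _ b' bc] lam by (simp add: r_def)
  also have "X *\<^sub>v (b' - b) = - g"
    using X bc b'c unfolding g_def
    by (simp add: mult_minus_distrib_mat_vec[of _ n p]) (auto intro!: eq_vecI)
  also have "r \<bullet> (- g) = - (r \<bullet> g)"
    using c by simp
  finally have "r \<bullet> g / real n \<le> t * (lam0 * (l1_norm b - l1_norm b'))"
    by (simp add: lam_def algebra_simps)
  also have "\<dots> \<le> t * (s' - s)"
    using pen t by (intro mult_left_mono) auto
  finally have "s' * (s' - s) \<le> t * (s' - s)"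
    using gap by linarith
  \<comment> \<open>The factor \<open>s' - s\<close> is positive because
    \<open>s < t \<le> s'\<close>; cancelling it gives \<open>s' \<le> t\<close>.\<close>
  then have s't: "s' = t"
    using ts' st by simp
  have r_eq: "r = (1 - \<tau>) \<cdot>\<^sub>v e"
  proof (rule eq_smult_of_norm_split[OF c(1,2)])
    show "l2_norm r = (1 - \<tau>) * l2_norm e"
      by (simp add: rn en s't t_def)
    have "e - r = X *\<^sub>v b' - X *\<^sub>v \<beta>s"
      using X y \<beta>s b'c unfolding e_def r_def by (auto intro!: eq_vecI)
    then show "l2_norm (e - r) \<le> \<tau> * l2_norm e"
      using h n_pos by (simp add: en pos_divide_le_eq mult_ac)
  qed (use \<tau> in simp)
  define \<mu> where "\<mu> = (1 - \<tau>) * \<zeta>"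
  have r_le: "r \<bullet> (X *\<^sub>v u) / real n \<le> \<mu> * l1_norm u" if u: "u \<in> carrier_vec p" for u
  proof -
    have "r \<bullet> (X *\<^sub>v u) / real n = (1 - \<tau>) * (e \<bullet> (X *\<^sub>v u) / real n)"
      using X u c unfolding r_eq by (simp add: smult_scalar_prod_distrib[of _ n])
    also have "\<dots> \<le> (1 - \<tau>) * (\<zeta> * l1_norm u)"
      using scalar_prod_mat_mult_le[OF X c(1) u] \<tau> by (intro mult_left_mono) (auto simp: e_def)
    finally show ?thesis by (simp add: \<mu>_def)
  qed
  have "\<mu> \<le> \<zeta>"
    using \<tau>_nonneg \<tau> linf_norm_nonneg by (simp add: \<mu>_def mult_left_le_one_le)
  also have "\<zeta> \<le> lam * ((\<xi> - 1) / (\<xi> + 1))"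
    using \<zeta>_le[of t] by (simp add: lam_def t_def)
  also have "\<dots> < lam * 1"
    using lam \<xi> by (intro mult_strict_left_mono) auto
  finally have \<mu>: "\<mu> < lam" by simp
  \<comment> \<open>Tested against 0, the penalty factor \<open>lam\<close> is set against the
    strictly smaller \<open>\<mu>\<close>, which leaves no room for a nonzero
    \<open>b'\<close>.\<close>
  have "lam * (l1_norm b' - l1_norm (0\<^sub>v p)) \<le> r \<bullet> (X *\<^sub>v (b' - 0\<^sub>v p)) / real n"
    using lasso_variational_inequality[OF X y _ b', of "0\<^sub>v p"] lam by (simp add: r_def)
  also have "b' - 0\<^sub>v p = b'"
    using b'c by simp
  also have "r \<bullet> (X *\<^sub>v b') / real n \<le> \<mu> * l1_norm b'"
    using r_le[OF b'c] .
  finally have "l1_norm b' = 0"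
    using \<mu> l1_norm_nonneg[of b'] by (simp add: mult_le_cancel_right)
  then have b'0: "b' = 0\<^sub>v p"
    using l1_norm_eq_0_iff[OF b'c] by simp
  have "lam * l1_norm b \<le> t * (s' - s)"
    using pen t by (simp add: b'0 lam_def mult.assoc)
  also have "\<dots> \<le> r \<bullet> g / real n"
    using gap by (simp add: s't)
  also have "\<dots> \<le> \<mu> * l1_norm b"
    using r_le[OF bc] bc by (simp add: g_def b'0)
  finally have "l1_norm b = 0"
    using \<mu> l1_norm_nonneg[of b] by (simp add: mult_le_cancel_right)
  \<comment> \<open>With \<open>b = 0\<close> the pairing in \<open>gap\<close> is at most
    \<open>\<mu> * 0\<close>, while its lower bound is positive.\<close>
  moreover have "0 < t * (s' - s)"
    using t st s't by simp
  ultimately show False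
    using gap r_le[OF bc] bc by (simp add: g_def b'0 s't)
qed

text \<open>If the residual level s exceeds \<open>\<sigma>s\<close>, scaling bounds the prediction
  error by \<open>s * \<tau>\<close>, while the triangle inequality bounds it below by
  \<open>s - \<sigma>s\<close>. The resulting bound on s, inserted in the oracle inequality by
  monotonicity, gives the second claim.\<close>

lemma sqrt_lasso_upper_bound:
  assumes b: "is_sqrt_lasso X y lam0 b"
  shows "(1 - \<tau>) * sigma_star X y b \<le> \<sigma>s"
    and "l2_norm (X *\<^sub>v b - X *\<^sub>v \<beta>s) / sqrt (real n) \<le> sqrt (eta_star X \<beta>s (\<sigma>s * lam0 / (1 - \<tau>)) \<xi>)"
proof -
  define s where "s = sigma_star X y b"
  have bc: "b \<in> carrier_vec p"
    using b X by (simp add: is_sqrt_lasso_def)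
  have lower: "(1 - \<tau>) * \<sigma>s \<le> s"
    using sqrt_lasso_lower_bound[OF b] by (simp add: s_def)
  moreover have "0 < (1 - \<tau>) * \<sigma>s"
    using \<tau> \<sigma>s by simp
  ultimately have s: "0 < s"
    by linarith
  then have pred: "l2_norm (X *\<^sub>v b - X *\<^sub>v \<beta>s) / sqrt (real n) \<le> sqrt (eta_star X \<beta>s (s * lam0) \<xi>)"
    using prediction_le[OF lower] sqrt_lasso_imp_lasso[OF X b] by (simp add: s_def)
  have upper: "(1 - \<tau>) * s \<le> \<sigma>s"
  proof (cases "\<sigma>s \<le> s")
    case True
    have "eta_star X \<beta>s (s * lam0) \<xi> = eta_star X \<beta>s (s / \<sigma>s * (\<sigma>s * lam0)) \<xi>"
      using \<sigma>s by simp
    also have "\<dots> \<le> (s / \<sigma>s)\<^sup>2 * (\<tau> * \<sigma>s)\<^sup>2"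
      using eta_star_scale[of "\<sigma>s * lam0" "s / \<sigma>s" X \<beta>s \<xi>] True \<sigma>s lam0 by (simp add: eta_star_\<sigma>s)
    also have "\<dots> = (s * \<tau>)\<^sup>2"
      using \<sigma>s by (simp add: power_divide power_mult_distrib)
    finally have "sqrt (eta_star X \<beta>s (s * lam0) \<xi>) \<le> s * \<tau>"
      using s \<tau>_nonneg by (intro real_le_lsqrt) auto
    then show ?thesis
      using pred sigma_star_diff_le[OF X y \<beta>s bc] by (simp add: s_def \<sigma>s_def algebra_simps)
  next
    case False
    have "(1 - \<tau>) * s \<le> s"
      using s \<tau>_nonneg \<tau> by (simp add: mult_left_le_one_le)
    with False show ?thesis by simp
  qed
  then show "(1 - \<tau>) * sigma_star X y b \<le> \<sigma>s"
    by (simp add: s_def)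
  have "s * lam0 \<le> \<sigma>s * lam0 / (1 - \<tau>)"
    using upper \<tau> lam0 by (simp add: pos_le_divide_eq mult_ac)
  then show "l2_norm (X *\<^sub>v b - X *\<^sub>v \<beta>s) / sqrt (real n) \<le> sqrt (eta_star X \<beta>s (\<sigma>s * lam0 / (1 - \<tau>)) \<xi>)"
    using s lam0 by (intro order_trans[OF pred] real_sqrt_le_mono eta_star_mono) auto
qed

lemma eta_star_rescaled_le: "sqrt (eta_star X \<beta>s (\<sigma>s * lam0 / (1 - \<tau>)) \<xi>) \<le> \<tau> * \<sigma>s / (1 - \<tau>)"
proof -
  have "eta_star X \<beta>s (\<sigma>s * lam0 / (1 - \<tau>)) \<xi> \<le> (1 / (1 - \<tau>))\<^sup>2 * (\<tau> * \<sigma>s)\<^sup>2"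
    using eta_star_scale[of "\<sigma>s * lam0" "1 / (1 - \<tau>)" X \<beta>s \<xi>] \<tau> \<tau>_nonneg \<sigma>s lam0
    by (simp add: eta_star_\<sigma>s)
  also have "\<dots> = (\<tau> * \<sigma>s / (1 - \<tau>))\<^sup>2"
    by (simp add: power_divide)
  finally show ?thesis
    using \<tau> \<tau>_nonneg \<sigma>s by (intro real_le_lsqrt) auto
qed

text \<open>The lower bound keeps the residual positive, so the infimum is attained. The random part
  relies on this, since its estimator is a solution only where one exists.\<close>

lemma scaled_lasso_exists:
  obtains b \<sigma> where "is_scaled_lasso X y lam0 b \<sigma>"
proof -
  obtain b where b: "is_sqrt_lasso X y lam0 b"
    using sqrt_lasso_exists[OF X y lam0] .
  moreover have "0 < (1 - \<tau>) * \<sigma>s"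
    using \<tau> \<sigma>s by simp
  then have "0 < sigma_star X y b"
    using sqrt_lasso_lower_bound[OF b] by linarith
  ultimately show ?thesis
    using that scaled_lasso_iff_sqrt_lasso[OF X n_pos] by blast
qed

lemma scaled_lasso_bounds:
  assumes "is_scaled_lasso X y lam0 b \<sigma>"
  shows "(1 - \<tau>) * \<sigma>s \<le> \<sigma>" "(1 - \<tau>) * \<sigma> \<le> \<sigma>s"
    "l2_norm (X *\<^sub>v b - X *\<^sub>v \<beta>s) / sqrt (real n) \<le> sqrt (eta_star X \<beta>s (\<sigma>s * lam0 / (1 - \<tau>)) \<xi>)"
  using assms sqrt_lasso_lower_bound sqrt_lasso_upper_bound
  by (auto simp: scaled_lasso_iff_sqrt_lasso[OF X n_pos])

end

text \<open>As \<open>z_star\<close> is nonnegative, its upper bound forces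
  \<open>\<tau> \<le> 1\<close>. At \<open>\<tau> = 1\<close> the ratio bounds follow from
  positivity and the other two have infinite right-hand sides.\<close>

lemma scaled_lasso_deterministic:
  assumes X: "X \<in> carrier_mat n p" and y: "y \<in> carrier_vec n" and \<beta>s: "\<beta>s \<in> carrier_vec p"
    and lam0: "lam0 > 0" and \<xi>: "\<xi> > 1" and lasso: "is_scaled_lasso X y lam0 \<beta>h \<sigma>h"
    and \<sigma>s: "sigma_star X y \<beta>s > 0"
    and z: "z_star X y \<beta>s \<le> (1 - tau0 X y \<beta>s lam0 \<xi>) * lam0 * (\<xi> - 1) / (\<xi> + 1)"
  shows "let \<sigma>s = sigma_star X y \<beta>s;
             \<tau> = tau0 X y \<beta>s lam0 \<xi>;
             mid = (if \<tau> = 1 then \<infinity>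
                    else ereal (1 / \<sigma>s * sqrt (eta_star X \<beta>s (\<sigma>s * lam0 / (1 - \<tau>)) \<xi>)))
         in max (1 - \<sigma>h / \<sigma>s) (1 - \<sigma>s / \<sigma>h) \<le> \<tau> \<and>
            ereal (l2_norm (X *\<^sub>v \<beta>h - X *\<^sub>v \<beta>s) / (sqrt (real n) * \<sigma>s)) \<le> mid \<and>
            mid \<le> (if \<tau> = 1 then \<infinity> else ereal (\<tau> / (1 - \<tau>)))"
proof -
  define \<sigma> where "\<sigma> = sigma_star X y \<beta>s"
  define \<tau> where "\<tau> = tau0 X y \<beta>s lam0 \<xi>"
  have \<sigma>: "\<sigma> > 0"
    using \<sigma>s by (simp add: \<sigma>_def)
  have \<sigma>h: "\<sigma>h > 0"
    using lasso by (simp add: is_scaled_lasso_def is_arg_min_def)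
  have "0 \<le> z_star X y \<beta>s"
    using \<sigma>s linf_norm_nonneg by (simp add: z_star_def)
  then have "0 \<le> (1 - \<tau>) * lam0 * (\<xi> - 1) / (\<xi> + 1)"
    using z by (simp add: \<tau>_def)
  then have "\<tau> \<le> 1"
    using lam0 \<xi> by (simp add: zero_le_divide_iff zero_le_mult_iff)
  show ?thesis
  proof (cases "\<tau> = 1")
    case True
    then show ?thesis
      using \<sigma> \<sigma>h unfolding Let_def \<sigma>_def[symmetric] \<tau>_def[symmetric] by simp
  next
    case False
    then have \<tau>: "\<tau> < 1"
      using \<open>\<tau> \<le> 1\<close> by simp
    interpret scaled_lasso_setup X y \<beta>s n p lam0 \<xi> \<sigma> \<tau>
      unfolding \<sigma>_def \<tau>_def using assms \<tau> by unfold_locales (auto simp: \<tau>_def)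
    have 1: "1 - \<sigma>h / \<sigma> \<le> \<tau>"
      using scaled_lasso_bounds(1)[OF lasso] \<sigma> by (simp add: field_simps)
    have 2: "1 - \<sigma> / \<sigma>h \<le> \<tau>"
      using scaled_lasso_bounds(2)[OF lasso] \<sigma>h by (simp add: field_simps)
    have 3: "l2_norm (X *\<^sub>v \<beta>h - X *\<^sub>v \<beta>s) / (sqrt (real n) * \<sigma>)
        \<le> 1 / \<sigma> * sqrt (eta_star X \<beta>s (\<sigma> * lam0 / (1 - \<tau>)) \<xi>)"
      using divide_right_mono[OF scaled_lasso_bounds(3)[OF lasso], of \<sigma>] \<sigma> by simp
    have 4: "1 / \<sigma> * sqrt (eta_star X \<beta>s (\<sigma> * lam0 / (1 - \<tau>)) \<xi>) \<le> \<tau> / (1 - \<tau>)"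
      using divide_right_mono[OF eta_star_rescaled_le, of \<sigma>] \<sigma> by simp
    show ?thesis
      using 1 2 3 4 False unfolding Let_def \<sigma>_def[symmetric] \<tau>_def[symmetric] by simp
  qed
qed

subsection \<open>Concentration of Gaussian noise\<close>

abbreviation normal_measure :: "real \<Rightarrow> real measure" where
  "normal_measure \<sigma> \<equiv> density lborel (\<lambda>x. ennreal (normal_density 0 \<sigma> x))"

abbreviation gauss_noise :: "nat \<Rightarrow> real \<Rightarrow> (nat \<Rightarrow> real) measure" where
  "gauss_noise n \<sigma> \<equiv> \<Pi>\<^sub>M i\<in>{..<n}. normal_measure \<sigma>"

lemma nn_integral_normal_density:
  assumes "\<sigma> > 0"
  shows "(\<integral>\<^sup>+x. ennreal (normal_density \<mu> \<sigma> x) \<partial>lborel) = 1"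
  using assms by (simp add: nn_integral_eq_integral)

text \<open>Completing the square: the exponential weight shifts the mean to
  \<open>a * \<sigma>\<^sup>2\<close>.\<close>

lemma nn_integral_exp_normal:
  assumes "\<sigma> > 0"
  shows "(\<integral>\<^sup>+x. ennreal (exp (a * x)) \<partial>normal_measure \<sigma>) = ennreal (exp (a\<^sup>2 * \<sigma>\<^sup>2 / 2))"
proof -
  have "normal_density 0 \<sigma> x * exp (a * x) = exp (a\<^sup>2 * \<sigma>\<^sup>2 / 2) * normal_density (a * \<sigma>\<^sup>2) \<sigma> x" for x
  proof -
    have "- (x - 0)\<^sup>2 / (2 * \<sigma>\<^sup>2) + a * x = a\<^sup>2 * \<sigma>\<^sup>2 / 2 + - (x - a * \<sigma>\<^sup>2)\<^sup>2 / (2 * \<sigma>\<^sup>2)"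
      using assms by (simp add: field_simps power2_eq_square)
    then show ?thesis
      unfolding normal_density_def by (simp add: mult_exp_exp)
  qed
  then have "(\<integral>\<^sup>+x. ennreal (exp (a * x)) \<partial>normal_measure \<sigma>) =
      (\<integral>\<^sup>+x. ennreal (exp (a\<^sup>2 * \<sigma>\<^sup>2 / 2)) * ennreal (normal_density (a * \<sigma>\<^sup>2) \<sigma> x) \<partial>lborel)"
    by (simp add: nn_integral_density flip: ennreal_mult')
  also have "\<dots> = ennreal (exp (a\<^sup>2 * \<sigma>\<^sup>2 / 2))"
    using assms by (simp add: nn_integral_cmult nn_integral_normal_density)
  finally show ?thesis .
qed

text \<open>The weight rescales the standard deviation to \<open>\<sigma> / q\<close>. The value
  \<open>1 / q\<close> is written as an exponential to fit the hypothesis of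
  \<open>chernoff_gauss_noise\<close>.\<close>

lemma nn_integral_exp_square_normal:
  assumes \<sigma>: "\<sigma> > 0" and s: "s < 1 / 2"
  shows "(\<integral>\<^sup>+x. ennreal (exp (s * (x / \<sigma>)\<^sup>2)) \<partial>normal_measure \<sigma>) = ennreal (exp (- ln (1 - 2 * s) / 2))"
proof -
  define q where "q = sqrt (1 - 2 * s)"
  have q: "q > 0" "q\<^sup>2 = 1 - 2 * s"
    using s by (auto simp: q_def)
  have "normal_density 0 \<sigma> x * exp (s * (x / \<sigma>)\<^sup>2) = 1 / q * normal_density 0 (\<sigma> / q) x" for x
  proof -
    have "- (x - 0)\<^sup>2 / (2 * \<sigma>\<^sup>2) + s * (x / \<sigma>)\<^sup>2 = - (x - 0)\<^sup>2 * q\<^sup>2 / (2 * \<sigma>\<^sup>2)"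
      unfolding q(2) using \<sigma> by (simp add: field_simps)
    also have "\<dots> = - (x - 0)\<^sup>2 / (2 * (\<sigma> / q)\<^sup>2)"
      by (simp add: power_divide)
    finally have "exp (- (x - 0)\<^sup>2 / (2 * \<sigma>\<^sup>2)) * exp (s * (x / \<sigma>)\<^sup>2) = exp (- (x - 0)\<^sup>2 / (2 * (\<sigma> / q)\<^sup>2))"
      by (simp only: mult_exp_exp)
    moreover have "1 / sqrt (2 * pi * \<sigma>\<^sup>2) = 1 / q * (1 / sqrt (2 * pi * (\<sigma> / q)\<^sup>2))"
      using \<sigma> q(1) by (simp add: real_sqrt_mult)
    ultimately show ?thesis
      unfolding normal_density_def by (simp only: mult.assoc)
  qed
  then have "(\<integral>\<^sup>+x. ennreal (exp (s * (x / \<sigma>)\<^sup>2)) \<partial>normal_measure \<sigma>) =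
      (\<integral>\<^sup>+x. ennreal (1 / q) * ennreal (normal_density 0 (\<sigma> / q) x) \<partial>lborel)"
    using q by (simp add: nn_integral_density flip: ennreal_mult')
  also have "\<dots> = ennreal (1 / q)"
    using \<sigma> q by (simp add: nn_integral_cmult nn_integral_normal_density)
  also have "1 / q = exp (- ln (1 - 2 * s) / 2)"
  proof -
    have "- ln (1 - 2 * s) / 2 = - ln q"
      using s by (simp add: q_def ln_sqrt)
    then show ?thesis
      using q by (simp add: exp_minus inverse_eq_divide)
  qed
  finally show ?thesis .
qed

section \<open>Chernoff bounds for linear and quadratic functions of the noise\<close>

lemma prob_space_gauss_noise: "\<sigma> > 0 \<Longrightarrow> prob_space (gauss_noise n \<sigma>)"
  by (intro prob_space_PiM prob_space_normal_density)

lemma measurable_gauss_noise_component: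
  assumes "i < n"
  shows "(\<lambda>e. e i) \<in> borel_measurable (gauss_noise n \<sigma>)"
proof -
  have "(\<lambda>e. e i) \<in> gauss_noise n \<sigma> \<rightarrow>\<^sub>M normal_measure \<sigma>"
    using assms by (intro measurable_component_singleton) simp
  then show ?thesis
    by (simp cong: measurable_cong_sets)
qed

text \<open>Markov's inequality for the exponential of the sum, whose integral factors over the
  product measure. The free exponential parameter is absorbed into \<open>g\<close> and
  \<open>t\<close>.\<close>

lemma chernoff_gauss_noise:
  fixes g :: "nat \<Rightarrow> real \<Rightarrow> real"
  assumes \<sigma>: "\<sigma> > 0" and g: "\<And>i. i < n \<Longrightarrow> g i \<in> borel_measurable borel"
    and m: "\<And>i. i < n \<Longrightarrow> (\<integral>\<^sup>+x. ennreal (exp (g i x)) \<partial>normal_measure \<sigma>) = ennreal (exp (m i))"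
  shows "{e \<in> space (gauss_noise n \<sigma>). t \<le> (\<Sum>i<n. g i (e i))} \<in> sets (gauss_noise n \<sigma>)" (is "?A \<in> _")
    and "measure (gauss_noise n \<sigma>) {e \<in> space (gauss_noise n \<sigma>). t \<le> (\<Sum>i<n. g i (e i))}
      \<le> exp ((\<Sum>i<n. m i) - t)"
proof -
  interpret M: prob_space "gauss_noise n \<sigma>"
    using \<sigma> by (rule prob_space_gauss_noise)
  interpret N: prob_space "normal_measure \<sigma>"
    using \<sigma> by (rule prob_space_normal_density)
  interpret P: product_sigma_finite "\<lambda>_. normal_measure \<sigma>"
    by unfold_locales
  have [measurable]: "(\<lambda>e. g i (e i)) \<in> borel_measurable (gauss_noise n \<sigma>)" if "i < n" for i
    using measurable_compose[OF measurable_gauss_noise_component g] that by blast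
  have S: "(\<lambda>e. \<Sum>i<n. g i (e i)) \<in> borel_measurable (gauss_noise n \<sigma>)"
    by (intro borel_measurable_sum) simp
  have S': "(\<lambda>e. (\<Sum>i<n. g i (e i)) * indicat_real (space (gauss_noise n \<sigma>)) e)
      \<in> borel_measurable (gauss_noise n \<sigma>)"
    using S by (intro borel_measurable_times borel_measurable_indicator) auto
  from S show A: "?A \<in> sets (gauss_noise n \<sigma>)"
    by measurable
  have "emeasure (gauss_noise n \<sigma>) ?A \<le> ennreal (exp (- t)) *
      (\<integral>\<^sup>+e. ennreal (exp (\<Sum>i<n. g i (e i))) * indicator (space (gauss_noise n \<sigma>)) e \<partial>gauss_noise n \<sigma>)"
    using Chernoff_ineq_nn_integral_ge[of 1 _ _ _ t, OF _ sets.top S'] by simp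
  also have "(\<integral>\<^sup>+e. ennreal (exp (\<Sum>i<n. g i (e i))) * indicator (space (gauss_noise n \<sigma>)) e \<partial>gauss_noise n \<sigma>)
      = (\<integral>\<^sup>+e. (\<Prod>i\<in>{..<n}. ennreal (exp (g i (e i)))) \<partial>gauss_noise n \<sigma>)"
    by (intro nn_integral_cong) (simp add: exp_sum prod_ennreal)
  also have "\<dots> = (\<Prod>i\<in>{..<n}. \<integral>\<^sup>+x. ennreal (exp (g i x)) \<partial>normal_measure \<sigma>)"
  proof (rule P.product_nn_integral_prod)
    fix i assume "i \<in> {..<n}"
    then have [measurable]: "g i \<in> borel_measurable borel"
      using g by simp
    show "(\<lambda>x. ennreal (exp (g i x))) \<in> borel_measurable (normal_measure \<sigma>)"
      by measurable
  qed simp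
  also have "\<dots> = ennreal (exp (\<Sum>i<n. m i))"
    by (simp add: m exp_sum prod_ennreal)
  also have "ennreal (exp (- t)) * ennreal (exp (\<Sum>i<n. m i)) = ennreal (exp ((\<Sum>i<n. m i) - t))"
    by (simp add: mult_exp_exp flip: ennreal_mult')
  finally show "measure (gauss_noise n \<sigma>) ?A \<le> exp ((\<Sum>i<n. m i) - t)"
    by (simp add: M.emeasure_eq_measure)
qed

lemma gauss_noise_linear_tail:
  assumes \<sigma>: "\<sigma> > 0" and S: "(\<Sum>i<n. (x i)\<^sup>2) > 0" and t: "t > 0"
  shows "{e \<in> space (gauss_noise n \<sigma>). t \<le> \<bar>\<Sum>i<n. x i * e i\<bar>} \<in> sets (gauss_noise n \<sigma>)" (is "?A \<in> _")
    and "measure (gauss_noise n \<sigma>) {e \<in> space (gauss_noise n \<sigma>). t \<le> \<bar>\<Sum>i<n. x i * e i\<bar>}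
      \<le> 2 * exp (- t\<^sup>2 / (2 * (\<Sum>i<n. (x i)\<^sup>2) * \<sigma>\<^sup>2))"
proof -
  define V where "V = (\<Sum>i<n. (x i)\<^sup>2) * \<sigma>\<^sup>2"
  have V: "V > 0"
    using \<sigma> S by (simp add: V_def)
  \<comment> \<open>The minimizer of the exponent \<open>s\<^sup>2 * V / 2 - s * t\<close>.\<close>
  define s where "s = t / V"
  have s: "s > 0"
    using V t by (simp add: s_def)
  \<comment> \<open>\<open>c = 1\<close> and \<open>c = - 1\<close> give the two one-sided
    events.\<close>
  define B where "B c = {e \<in> space (gauss_noise n \<sigma>). s * t \<le> (\<Sum>i<n. (c * s * x i) * e i)}" for c
  have B: "B c \<in> sets (gauss_noise n \<sigma>) \<and> measure (gauss_noise n \<sigma>) (B c) \<le> exp (- t\<^sup>2 / (2 * V))"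
    if c: "c\<^sup>2 = 1" for c
  proof -
    have "(\<Sum>i<n. (c * s * x i)\<^sup>2 * \<sigma>\<^sup>2 / 2) - s * t = s\<^sup>2 * V / 2 - s * t"
      by (simp add: V_def power_mult_distrib c sum_distrib_left sum_distrib_right sum_divide_distrib mult_ac)
    also have "\<dots> = - t\<^sup>2 / (2 * V)"
      using V by (simp add: s_def field_simps power2_eq_square)
    finally have eq: "(\<Sum>i<n. (c * s * x i)\<^sup>2 * \<sigma>\<^sup>2 / 2) - s * t = - t\<^sup>2 / (2 * V)" .
    show ?thesis
      using chernoff_gauss_noise[OF \<sigma>, of n "\<lambda>i z. (c * s * x i) * z" "\<lambda>i. (c * s * x i)\<^sup>2 * \<sigma>\<^sup>2 / 2" "s * t",
          OF _ nn_integral_exp_normal[OF \<sigma>]]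
      unfolding B_def eq by simp
  qed
  have "?A = B 1 \<union> B (- 1)"
  proof -
    have "(\<Sum>i<n. (c * s * x i) * e i) = s * (c * (\<Sum>i<n. x i * e i))" for c e
      by (simp add: sum_distrib_left mult_ac)
    then have "B c = {e \<in> space (gauss_noise n \<sigma>). t \<le> c * (\<Sum>i<n. x i * e i)}" for c
      using s by (simp add: B_def mult_le_cancel_left_pos)
    then show ?thesis
      by (auto simp: abs_if)
  qed
  with B[of 1] B[of "- 1"] show "?A \<in> sets (gauss_noise n \<sigma>)"
    by (simp add: sets.Un)
  have "measure (gauss_noise n \<sigma>) (B 1 \<union> B (- 1)) \<le> 2 * exp (- t\<^sup>2 / (2 * V))"
    using B[of 1] B[of "- 1"] measure_Un_le[of "B 1" "gauss_noise n \<sigma>" "B (- 1)"] by simp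
  then show "measure (gauss_noise n \<sigma>) ?A \<le> 2 * exp (- t\<^sup>2 / (2 * (\<Sum>i<n. (x i)\<^sup>2) * \<sigma>\<^sup>2))"
    using \<open>?A = B 1 \<union> B (- 1)\<close> by (simp add: V_def mult.assoc)
qed

lemma gauss_noise_square_tail:
  assumes \<sigma>: "\<sigma> > 0" and \<delta>: "0 < \<delta>" "\<delta> \<le> 1"
  shows "{e \<in> space (gauss_noise n \<sigma>). real n * \<delta> \<le> \<bar>(\<Sum>i<n. (e i / \<sigma>)\<^sup>2) - real n\<bar>} \<in> sets (gauss_noise n \<sigma>)"
      (is "?A \<in> _")
    and "measure (gauss_noise n \<sigma>) {e \<in> space (gauss_noise n \<sigma>). real n * \<delta> \<le> \<bar>(\<Sum>i<n. (e i / \<sigma>)\<^sup>2) - real n\<bar>}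
      \<le> 2 * exp (- (\<delta>\<^sup>2 / 16) * real n)"
proof -
  define B where "B s u = {e \<in> space (gauss_noise n \<sigma>). s * (real n * u) \<le> (\<Sum>i<n. s * (e i / \<sigma>)\<^sup>2)}" for s u
  have B: "B s u \<in> sets (gauss_noise n \<sigma>) \<and> measure (gauss_noise n \<sigma>) (B s u) \<le> exp (- (\<delta>\<^sup>2 / 16) * real n)"
    if s: "s < 1 / 2" and rate: "- ln (1 - 2 * s) / 2 - s * u \<le> - (\<delta>\<^sup>2 / 16)" for s u
  proof -
    have "(\<Sum>i<n. - ln (1 - 2 * s) / 2) - s * (real n * u) = (- ln (1 - 2 * s) / 2 - s * u) * real n"
      by (simp add: algebra_simps)
    also have "\<dots> \<le> - (\<delta>\<^sup>2 / 16) * real n"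
      using rate by (rule mult_right_mono) simp
    finally have "exp ((\<Sum>i<n. - ln (1 - 2 * s) / 2) - s * (real n * u)) \<le> exp (- (\<delta>\<^sup>2 / 16) * real n)"
      by simp
    then show ?thesis
      using chernoff_gauss_noise[OF \<sigma>, of n "\<lambda>i z. s * (z / \<sigma>)\<^sup>2" "\<lambda>i. - ln (1 - 2 * s) / 2" "s * (real n * u)",
          OF _ nn_integral_exp_square_normal[OF \<sigma> s]]
      unfolding B_def by (auto intro: order_trans)
  qed
  \<comment> \<open>The exponents \<open>\<delta> / 8\<close> and \<open>- (\<delta> / 8)\<close>
    are not optimal, but elementary second-order bounds on the logarithm then give the rate
    \<open>\<delta>\<^sup>2 / 16\<close> in both tails. A negative exponent reverses the inequality
    and so yields the lower tail.\<close>
  define B1 where "B1 = B (\<delta> / 8) (1 + \<delta>)"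
  define B2 where "B2 = B (- (\<delta> / 8)) (1 - \<delta>)"
  have "- ln (1 - \<delta> / 4) / 2 \<le> \<delta> / 8 + (\<delta> / 4)\<^sup>2"
    using ln_one_minus_pos_lower_bound[of "\<delta> / 4"] \<delta> by simp
  then have "- ln (1 - 2 * (\<delta> / 8)) / 2 - \<delta> / 8 * (1 + \<delta>) \<le> - (\<delta>\<^sup>2 / 16)"
    by (simp add: power2_eq_square algebra_simps)
  then have B1: "B1 \<in> sets (gauss_noise n \<sigma>) \<and> measure (gauss_noise n \<sigma>) B1 \<le> exp (- (\<delta>\<^sup>2 / 16) * real n)"
    using \<delta> unfolding B1_def by (intro B) auto
  have "- ln (1 + \<delta> / 4) / 2 \<le> - (\<delta> / 8) + (\<delta> / 4)\<^sup>2 / 2"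
    using ln_one_plus_pos_lower_bound[of "\<delta> / 4"] \<delta> by simp
  then have "- ln (1 - 2 * (- (\<delta> / 8))) / 2 - (- (\<delta> / 8)) * (1 - \<delta>) \<le> - (\<delta>\<^sup>2 / 16)"
    by (simp add: power2_eq_square algebra_simps add_divide_distrib diff_divide_distrib)
      (use zero_le_square[of \<delta>] in linarith)
  then have B2: "B2 \<in> sets (gauss_noise n \<sigma>) \<and> measure (gauss_noise n \<sigma>) B2 \<le> exp (- (\<delta>\<^sup>2 / 16) * real n)"
    using \<delta> unfolding B2_def by (intro B) auto
  have A: "?A = B1 \<union> B2"
  proof -
    have "real n * \<delta> \<le> \<bar>S - real n\<bar> \<longleftrightarrow> real n * (1 + \<delta>) \<le> S \<or> S \<le> real n * (1 - \<delta>)" for S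
      unfolding distrib_left right_diff_distrib by linarith
    moreover have "B1 = {e \<in> space (gauss_noise n \<sigma>). real n * (1 + \<delta>) \<le> (\<Sum>i<n. (e i / \<sigma>)\<^sup>2)}"
      using \<delta> by (simp only: B1_def B_def sum_distrib_left[symmetric] mult_le_cancel_left_pos
          zero_less_divide_iff zero_less_numeral simp_thms)
    moreover have "B2 = {e \<in> space (gauss_noise n \<sigma>). (\<Sum>i<n. (e i / \<sigma>)\<^sup>2) \<le> real n * (1 - \<delta>)}"
      using \<delta> by (simp only: B2_def B_def sum_distrib_left[symmetric] mult_le_cancel_left_neg
          neg_less_0_iff_less zero_less_divide_iff zero_less_numeral simp_thms)
    ultimately show ?thesis
      by blast
  qed
  then show "?A \<in> sets (gauss_noise n \<sigma>)"
    using B1 B2 by (simp add: sets.Un)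
  show "measure (gauss_noise n \<sigma>) ?A \<le> 2 * exp (- (\<delta>\<^sup>2 / 16) * real n)"
    using B1 B2 measure_Un_le[of B1 "gauss_noise n \<sigma>" B2] unfolding A by simp
qed

subsection \<open>Consistency of the noise level estimator\<close>

text \<open>Of the two factors \<open>1 - \<delta>\<close> in the noise bound, one pays for
  \<open>\<sigma>s \<ge> (1 - \<delta>) * \<sigma>\<close> and one for
  \<open>\<tau> \<le> \<delta>\<close>. The constant 3 yields \<open>\<tau> \<le> \<delta>\<close>
  because \<open>(1 + \<delta>) / 3 \<le> 1 - \<delta>\<close> for
  \<open>\<delta> \<le> 1 / 2\<close>.\<close>

lemma scaled_lasso_noise_level_close:
  assumes X: "X \<in> carrier_mat n p" and y: "y \<in> carrier_vec n" and \<beta>s: "\<beta>s \<in> carrier_vec p"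
    and \<sigma>: "\<sigma> > 0" and lam0: "lam0 > 0" and \<xi>: "\<xi> > 1" and \<delta>: "0 < \<delta>" "\<delta> \<le> 1 / 2"
    and noise: "\<bar>(sigma_star X y \<beta>s / \<sigma>)\<^sup>2 - 1\<bar> \<le> \<delta>"
    and eta: "eta_star X \<beta>s (\<sigma> * lam0) \<xi> / \<sigma>\<^sup>2 \<le> (\<delta> / 3)\<^sup>2"
    and z: "linf_norm ((1 / real n) \<cdot>\<^sub>v (X\<^sup>T *\<^sub>v (y - X *\<^sub>v \<beta>s))) \<le> (1 - \<delta>)\<^sup>2 * \<sigma> * (lam0 * (\<xi> - 1) / (\<xi> + 1))"
    and lasso: "(\<exists>b s. is_scaled_lasso X y lam0 b s) \<Longrightarrow> is_scaled_lasso X y lam0 \<beta>h \<sigma>h"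
  shows "\<bar>\<sigma>h / \<sigma> - 1\<bar> \<le> 4 * \<delta>"
proof -
  define \<sigma>s where "\<sigma>s = sigma_star X y \<beta>s"
  define \<tau> where "\<tau> = tau0 X y \<beta>s lam0 \<xi>"
  define \<rho> where "\<rho> = \<sigma>s / \<sigma>"
  have \<rho>0: "0 \<le> \<rho>"
    using \<sigma> sigma_star_nonneg[of X y \<beta>s] by (simp add: \<rho>_def \<sigma>s_def)
  \<comment> \<open>The factor \<open>\<rho> + 1\<close> is at least 1, so closeness of the square
    to 1 passes to \<open>\<rho>\<close> itself.\<close>
  have "\<bar>\<rho> - 1\<bar> * 1 \<le> \<bar>\<rho> - 1\<bar> * (\<rho> + 1)"
    using \<rho>0 by (intro mult_left_mono) auto
  also have "\<dots> = \<bar>(\<rho> - 1) * (\<rho> + 1)\<bar>"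
    using \<rho>0 by (simp add: abs_mult)
  also have "(\<rho> - 1) * (\<rho> + 1) = \<rho>\<^sup>2 - 1"
    by (simp add: power2_eq_square algebra_simps)
  finally have "\<bar>\<rho> - 1\<bar> \<le> \<delta>"
    using noise by (simp add: \<rho>_def \<sigma>s_def)
  then have \<rho>: "1 - \<delta> \<le> \<rho>" "\<rho> \<le> 1 + \<delta>"
    by auto
  have \<sigma>s_bounds: "(1 - \<delta>) * \<sigma> \<le> \<sigma>s" "\<sigma>s \<le> (1 + \<delta>) * \<sigma>"
    using \<rho> \<sigma> by (simp_all add: \<rho>_def pos_le_divide_eq pos_divide_le_eq)
  moreover have "0 < (1 - \<delta>) * \<sigma>"
    using \<sigma> \<delta> by simp
  ultimately have \<sigma>s_pos: "0 < \<sigma>s"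
    by linarith
  have "eta_star X \<beta>s (\<sigma>s * lam0) \<xi> \<le> eta_star X \<beta>s ((1 + \<delta>) * (\<sigma> * lam0)) \<xi>"
    using \<sigma>s_bounds(2) \<sigma>s_pos lam0 by (intro eta_star_mono) (simp_all flip: mult.assoc)
  also have "\<dots> \<le> (1 + \<delta>)\<^sup>2 * eta_star X \<beta>s (\<sigma> * lam0) \<xi>"
    using \<sigma> lam0 \<delta> by (intro eta_star_scale) auto
  also have "\<dots> \<le> (1 + \<delta>)\<^sup>2 * ((\<delta> / 3)\<^sup>2 * \<sigma>\<^sup>2)"
    using eta \<sigma> by (intro mult_left_mono) (auto simp: pos_divide_le_eq)
  also have "\<dots> = ((1 + \<delta>) * (\<delta> / 3) * \<sigma>)\<^sup>2"
    by (simp only: power_mult_distrib mult.assoc)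
  finally have "sqrt (eta_star X \<beta>s (\<sigma>s * lam0) \<xi>) \<le> (1 + \<delta>) * (\<delta> / 3) * \<sigma>"
    using \<sigma> \<delta> by (intro real_le_lsqrt) auto
  also have "\<dots> \<le> \<delta> * ((1 - \<delta>) * \<sigma>)"
  proof -
    have "(1 + \<delta>) / 3 \<le> 1 - \<delta>"
      using \<delta> by simp
    then have "\<delta> * ((1 + \<delta>) / 3 * \<sigma>) \<le> \<delta> * ((1 - \<delta>) * \<sigma>)"
      using \<delta> \<sigma> by (intro mult_left_mono mult_right_mono) auto
    then show ?thesis by (simp add: mult_ac)
  qed
  also have "\<dots> \<le> \<delta> * \<sigma>s"
    using \<sigma>s_bounds(1) \<delta> by (intro mult_left_mono) auto
  finally have \<tau>_le: "\<tau> \<le> \<delta>"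
    using \<sigma>s_pos by (simp add: \<tau>_def tau0_def \<sigma>s_def pos_divide_le_eq)
  define k where "k = lam0 * (\<xi> - 1) / (\<xi> + 1)"
  have k: "0 \<le> k"
    using lam0 \<xi> by (simp add: k_def)
  have "linf_norm ((1 / real n) \<cdot>\<^sub>v (X\<^sup>T *\<^sub>v (y - X *\<^sub>v \<beta>s))) \<le> (1 - \<delta>) * k * ((1 - \<delta>) * \<sigma>)"
    using z by (simp add: k_def power2_eq_square mult_ac)
  also have "\<dots> \<le> (1 - \<delta>) * k * \<sigma>s"
    using \<sigma>s_bounds(1) \<delta> k by (intro mult_left_mono) auto
  also have "\<dots> \<le> (1 - \<tau>) * k * \<sigma>s"
    using \<tau>_le k \<sigma>s_pos by (intro mult_right_mono) auto
  finally have "z_star X y \<beta>s \<le> (1 - \<tau>) * k"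
    using X \<sigma>s_pos unfolding z_star_def \<sigma>s_def[symmetric] by (simp add: pos_divide_le_eq)
  then have z': "z_star X y \<beta>s \<le> (1 - \<tau>) * lam0 * (\<xi> - 1) / (\<xi> + 1)"
    by (simp add: k_def mult_ac)
  interpret scaled_lasso_setup X y \<beta>s n p lam0 \<xi> \<sigma>s \<tau>
    unfolding \<sigma>s_def \<tau>_def
    using X y \<beta>s lam0 \<xi> \<sigma>s_pos \<tau>_le \<delta> z' by unfold_locales (auto simp: \<sigma>s_def \<tau>_def)
  have "is_scaled_lasso X y lam0 \<beta>h \<sigma>h"
    using lasso scaled_lasso_exists by metis
  note bounds = scaled_lasso_bounds(1,2)[OF this]
  have "(1 - \<delta>) * ((1 - \<delta>) * \<sigma>) \<le> (1 - \<tau>) * \<sigma>s"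
    using \<tau>_le \<delta> \<sigma> \<sigma>s_bounds by (intro mult_mono) auto
  then have 1: "(1 - \<delta>)\<^sup>2 * \<sigma> \<le> \<sigma>h"
    using bounds(1) by (simp add: power2_eq_square mult.assoc)
  then have "0 \<le> \<sigma>h"
    using \<sigma> by (meson order_trans zero_le_mult_iff zero_le_power2 less_imp_le)
  then have "(1 - \<delta>) * \<sigma>h \<le> (1 - \<tau>) * \<sigma>h"
    using \<tau>_le by (intro mult_right_mono) auto
  then have "(1 - \<delta>) * \<sigma>h \<le> (1 + \<delta>) * \<sigma>"
    using bounds(2) \<sigma>s_bounds(2) by linarith
  then have 2: "(1 - \<delta>) * (\<sigma>h / \<sigma>) \<le> 1 + \<delta>"
    using \<sigma> by (simp add: pos_divide_le_eq)
  have "1 - 4 * \<delta> \<le> (1 - \<delta>)\<^sup>2"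
    using \<delta> by (simp add: power2_eq_square algebra_simps)
  also have "\<dots> \<le> \<sigma>h / \<sigma>"
    using 1 \<sigma> by (simp add: pos_le_divide_eq)
  finally have lower: "1 - 4 * \<delta> \<le> \<sigma>h / \<sigma>" .
  have "2 * \<delta> * \<delta> \<le> 1 * \<delta>"
    using \<delta> by (intro mult_right_mono) auto
  then have "1 + \<delta> \<le> (1 - \<delta>) * (1 + 4 * \<delta>)"
    using \<delta> by (simp add: algebra_simps)
  then have "(1 - \<delta>) * (\<sigma>h / \<sigma>) \<le> (1 - \<delta>) * (1 + 4 * \<delta>)"
    using 2 by linarith
  then have "\<sigma>h / \<sigma> \<le> 1 + 4 * \<delta>"
    using \<delta> by (subst (asm) mult_le_cancel_left_pos) auto
  with lower show ?thesis
    by (simp add: abs_le_iff)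
qed

text \<open>Each column correlation has variance \<open>n * \<sigma>\<^sup>2\<close>, so the
  threshold is chosen to make its tail \<open>2 * p powr (- c\<^sup>2)\<close>; the union over p
  columns raises the exponent by 1.\<close>

lemma gauss_noise_exceptional_set:
  assumes X: "X \<in> carrier_mat n p" and cols: "\<And>j. j < p \<Longrightarrow> (l2_norm (col X j))\<^sup>2 = real n"
    and n: "n > 0" and p: "p \<ge> 2" and \<sigma>: "\<sigma> > 0" and \<delta>: "0 < \<delta>" "\<delta> \<le> 1" and c: "c > 0"
  obtains B where "B \<in> sets (gauss_noise n \<sigma>)"
    "measure (gauss_noise n \<sigma>) B \<le> 2 * exp (- (\<delta>\<^sup>2 / 16) * real n) + 2 * real p powr (1 - c\<^sup>2)"
    "\<And>e. e \<in> space (gauss_noise n \<sigma>) \<Longrightarrow> e \<notin> B \<Longrightarrow>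
       \<bar>(\<Sum>i<n. (e i / \<sigma>)\<^sup>2) - real n\<bar> < real n * \<delta> \<and>
       (\<forall>j<p. \<bar>\<Sum>i<n. X $$ (i, j) * e i\<bar> < real n * (c * \<sigma> * sqrt (2 / real n * ln (real p))))"
proof -
  let ?M = "gauss_noise n \<sigma>"
  define t where "t = real n * (c * \<sigma> * sqrt (2 / real n * ln (real p)))"
  define B1 where "B1 = {e \<in> space ?M. real n * \<delta> \<le> \<bar>(\<Sum>i<n. (e i / \<sigma>)\<^sup>2) - real n\<bar>}"
  define B2 where "B2 j = {e \<in> space ?M. t \<le> \<bar>\<Sum>i<n. X $$ (i, j) * e i\<bar>}" for j
  have lnp: "ln (real p) > 0"
    using p by simp
  have t: "t > 0"
    using n c \<sigma> lnp by (simp add: t_def)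
  have B1: "B1 \<in> sets ?M" "measure ?M B1 \<le> 2 * exp (- (\<delta>\<^sup>2 / 16) * real n)"
    unfolding B1_def using gauss_noise_square_tail[OF \<sigma> \<delta>] by blast+
  have B2: "B2 j \<in> sets ?M \<and> measure ?M (B2 j) \<le> 2 * real p powr (- c\<^sup>2)" if j: "j < p" for j
  proof -
    have col: "(\<Sum>i<n. (X $$ (i, j))\<^sup>2) = real n"
      using cols[OF j] X j by (simp add: l2_norm_def sum_nonneg)
    have "t\<^sup>2 = (real n)\<^sup>2 * (c\<^sup>2 * \<sigma>\<^sup>2 * (2 / real n * ln (real p)))"
      using lnp by (simp add: t_def power_mult_distrib)
    then have "- t\<^sup>2 / (2 * real n * \<sigma>\<^sup>2) = - c\<^sup>2 * ln (real p)"
      using n \<sigma> by (simp add: power2_eq_square)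
    then have "exp (- t\<^sup>2 / (2 * (\<Sum>i<n. (X $$ (i, j))\<^sup>2) * \<sigma>\<^sup>2)) = real p powr (- c\<^sup>2)"
      using p by (simp add: col powr_def)
    then show ?thesis
      unfolding B2_def using gauss_noise_linear_tail[OF \<sigma> _ t, where n = n and x = "\<lambda>i. X $$ (i, j)"] col n by simp
  qed
  define B where "B = B1 \<union> (\<Union>j\<in>{..<p}. B2 j)"
  have U: "(\<Union>j\<in>{..<p}. B2 j) \<in> sets ?M"
    using B2 by (intro sets.finite_UN) auto
  have "measure ?M (\<Union>j\<in>{..<p}. B2 j) \<le> (\<Sum>j<p. measure ?M (B2 j))"
    using B2 by (intro measure_UNION_le) auto
  also have "\<dots> \<le> (\<Sum>j<p. 2 * real p powr (- c\<^sup>2))"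
    using B2 by (intro sum_mono) auto
  also have "\<dots> = 2 * real p powr (1 - c\<^sup>2)"
    using p by (simp add: powr_diff powr_minus_divide)
  finally have "measure ?M B \<le> 2 * exp (- (\<delta>\<^sup>2 / 16) * real n) + 2 * real p powr (1 - c\<^sup>2)"
    using measure_Un_le[OF B1(1) U] B1(2) by (simp add: B_def)
  moreover have "B \<in> sets ?M"
    using B1(1) U by (simp add: B_def sets.Un)
  ultimately show ?thesis
    by (intro that[of B]) (auto simp: B_def B1_def B2_def t_def not_le)
qed

text \<open>Pulled back to the noise space, the deviation event lies in the exceptional set, off
  which the deterministic estimate applies. Measurability of \<open>\<sigma>h\<close> allows the
  probability to be computed as that of the preimage.\<close>

lemma gauss_pr_scaled_lasso_deviation_le:
  assumes X: "X \<in> carrier_mat n p" and \<beta>s: "\<beta>s \<in> carrier_vec p"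
    and cols: "\<And>j. j < p \<Longrightarrow> (l2_norm (col X j))\<^sup>2 = real n"
    and n: "n > 0" and p: "p \<ge> 2" and \<sigma>: "\<sigma> > 0" and \<xi>: "\<xi> > 1" and A: "A > 0"
    and \<delta>: "0 < \<delta>" "\<delta> \<le> 1 / 2" "4 * \<delta> \<le> \<epsilon>"
    and lam0: "lam0 = A * sqrt (2 / real n * ln (real p))"
    and eta: "eta_star X \<beta>s (\<sigma> * lam0) \<xi> / \<sigma>\<^sup>2 \<le> (\<delta> / 3)\<^sup>2"
    and meas: "\<sigma>h \<in> borel_measurable (vec_borel n)"
    and lasso: "\<And>y. y \<in> carrier_vec n \<Longrightarrow> (\<exists>b s. is_scaled_lasso X y lam0 b s) \<Longrightarrow>
       is_scaled_lasso X y lam0 (\<beta>h y) (\<sigma>h y)"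
  shows "measure (gauss_pr X \<beta>s \<sigma>) {y \<in> carrier_vec n. \<bar>\<sigma>h y / \<sigma> - 1\<bar> > \<epsilon>}
    \<le> 2 * exp (- (\<delta>\<^sup>2 / 16) * real n) + 2 * real p powr (1 - ((1 - \<delta>)\<^sup>2 * (A * (\<xi> - 1) / (\<xi> + 1)))\<^sup>2)"
proof -
  let ?M = "gauss_noise n \<sigma>"
  interpret M: prob_space ?M
    using \<sigma> by (rule prob_space_gauss_noise)
  define E where "E = {y \<in> carrier_vec n. \<bar>\<sigma>h y / \<sigma> - 1\<bar> > \<epsilon>}"
  \<comment> \<open>With this value the column threshold \<open>c * \<sigma> * L\<close> is exactly
    the noise bound required by \<open>scaled_lasso_noise_level_close\<close>.\<close>
  define c where "c = (1 - \<delta>)\<^sup>2 * (A * (\<xi> - 1) / (\<xi> + 1))"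
  define L where "L = sqrt (2 / real n * ln (real p))"
  define Y where "Y = (\<lambda>e. X *\<^sub>v \<beta>s + Matrix.vec n e)"
  have c: "c > 0"
    using \<delta> A \<xi> by (simp add: c_def)
  have L: "L > 0"
    using n p by (simp add: L_def)
  have dim: "dim_row X = n"
    using X by simp
  have E: "E \<in> sets (vec_borel n)"
  proof -
    note [measurable] = meas
    have "E = {y \<in> space (vec_borel n). \<bar>\<sigma>h y / \<sigma> - 1\<bar> > \<epsilon>}"
      by (simp add: E_def vec_borel_def)
    also have "\<dots> \<in> sets (vec_borel n)"
      by measurable
    finally show ?thesis .
  qed
  have Y: "Y \<in> ?M \<rightarrow>\<^sub>M vec_borel n"
    unfolding Y_def by (rule measurable_gauss_pr_map[OF dim])
  obtain B where B: "B \<in> sets ?M"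
      "measure ?M B \<le> 2 * exp (- (\<delta>\<^sup>2 / 16) * real n) + 2 * real p powr (1 - c\<^sup>2)"
    and good: "\<And>e. e \<in> space ?M \<Longrightarrow> e \<notin> B \<Longrightarrow>
       \<bar>(\<Sum>i<n. (e i / \<sigma>)\<^sup>2) - real n\<bar> < real n * \<delta> \<and>
       (\<forall>j<p. \<bar>\<Sum>i<n. X $$ (i, j) * e i\<bar> < real n * (c * \<sigma> * L))"
    using gauss_noise_exceptional_set[OF X cols n p \<sigma> \<delta>(1) _ c] \<delta>(2) unfolding L_def by auto
  have "Y -` E \<inter> space ?M \<subseteq> B"
  proof
    fix e assume e: "e \<in> Y -` E \<inter> space ?M"
    show "e \<in> B"
    proof (rule ccontr)
      assume "e \<notin> B"
      then have sq: "\<bar>(\<Sum>i<n. (e i / \<sigma>)\<^sup>2) - real n\<bar> < real n * \<delta>"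
        and lin: "\<And>j. j < p \<Longrightarrow> \<bar>\<Sum>i<n. X $$ (i, j) * e i\<bar> < real n * (c * \<sigma> * L)"
        using good e by auto
      have Yc: "Y e \<in> carrier_vec n"
        using X \<beta>s by (simp add: Y_def)
      have res: "Y e - X *\<^sub>v \<beta>s = Matrix.vec n e"
        using X \<beta>s by (intro eq_vecI) (auto simp: Y_def)
      have "(sigma_star X (Y e) \<beta>s / \<sigma>)\<^sup>2 = (\<Sum>i<n. (e i / \<sigma>)\<^sup>2) / real n"
        by (simp add: power_divide sigma_star_power2 res dim l2_norm_def sum_nonneg sum_divide_distrib mult.commute)
      then have "(sigma_star X (Y e) \<beta>s / \<sigma>)\<^sup>2 - 1 = ((\<Sum>i<n. (e i / \<sigma>)\<^sup>2) - real n) / real n"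
        using n by (simp add: diff_divide_distrib)
      then have noise: "\<bar>(sigma_star X (Y e) \<beta>s / \<sigma>)\<^sup>2 - 1\<bar> \<le> \<delta>"
        using sq n by (simp add: abs_divide pos_divide_le_eq mult.commute)
      have "linf_norm ((1 / real n) \<cdot>\<^sub>v (X\<^sup>T *\<^sub>v (Y e - X *\<^sub>v \<beta>s))) \<le> c * \<sigma> * L"
      proof (rule linf_norm_le)
        show "0 \<le> c * \<sigma> * L"
          using c \<sigma> L by simp
        fix j assume "j < dim_vec ((1 / real n) \<cdot>\<^sub>v (X\<^sup>T *\<^sub>v (Y e - X *\<^sub>v \<beta>s)))"
        then have j: "j < p"
          using X by simp
        have "((1 / real n) \<cdot>\<^sub>v (X\<^sup>T *\<^sub>v (Y e - X *\<^sub>v \<beta>s))) $ j = (\<Sum>i<n. X $$ (i, j) * e i) / real n"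
          using X j by (simp add: res scalar_prod_def lessThan_atLeast0)
        then show "\<bar>((1 / real n) \<cdot>\<^sub>v (X\<^sup>T *\<^sub>v (Y e - X *\<^sub>v \<beta>s))) $ j\<bar> \<le> c * \<sigma> * L"
          using lin[OF j] n by (simp add: abs_divide pos_divide_le_eq mult.commute)
      qed
      also have "c * \<sigma> * L = (1 - \<delta>)\<^sup>2 * \<sigma> * (lam0 * (\<xi> - 1) / (\<xi> + 1))"
        by (simp add: c_def lam0 L_def mult_ac)
      finally have "\<bar>\<sigma>h (Y e) / \<sigma> - 1\<bar> \<le> 4 * \<delta>"
        using A L lasso[OF Yc]
        by (intro scaled_lasso_noise_level_close[OF X Yc \<beta>s \<sigma> _ \<xi> \<delta>(1,2) noise eta])
          (auto simp: lam0 L_def)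
      then show False
        using e \<delta>(3) by (simp add: E_def)
    qed
  qed
  then have "measure ?M (Y -` E \<inter> space ?M) \<le> measure ?M B"
    using B(1) by (intro M.finite_measure_mono)
  moreover have "gauss_pr X \<beta>s \<sigma> = distr ?M (vec_borel n) Y"
    by (simp add: gauss_pr_def dim Y_def)
  ultimately show ?thesis
    using B(2) Y E by (simp add: measure_distr c_def E_def[symmetric])
qed

text \<open>The margin \<open>\<delta>\<close> depends on \<open>\<xi>\<close>, \<open>A\<close> and
  \<open>\<epsilon>\<close> but not on \<open>n\<close>. One error term therefore vanishes as n
  grows and the other as p grows, its exponent being a fixed negative number.\<close>

lemma scaled_lasso_noise_level_consistent:
  fixes p :: "nat \<Rightarrow> nat" and X :: "nat \<Rightarrow> real mat" and \<beta>s :: "nat \<Rightarrow> real vec"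
    and \<sigma> lam0 :: "nat \<Rightarrow> real" and \<beta>h :: "nat \<Rightarrow> real vec \<Rightarrow> real vec" and \<sigma>h :: "nat \<Rightarrow> real vec \<Rightarrow> real"
  assumes p: "filterlim p at_top sequentially"
    and X: "\<And>n. X n \<in> carrier_mat n (p n)" and \<beta>s: "\<And>n. \<beta>s n \<in> carrier_vec (p n)"
    and \<sigma>: "\<And>n. \<sigma> n > 0"
    and cols: "\<And>n j. j < p n \<Longrightarrow> (l2_norm (col (X n) j))\<^sup>2 = real n"
    and \<xi>: "\<xi> > 1" and A: "A > (\<xi> + 1) / (\<xi> - 1)"
    and lam0: "\<And>n. lam0 n = A * sqrt (2 / real n * ln (real (p n)))"
    and eta: "(\<lambda>n. eta_star (X n) (\<beta>s n) (\<sigma> n * lam0 n) \<xi> / (\<sigma> n)\<^sup>2) \<longlonglongrightarrow> 0"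
    and meas: "\<And>n. \<sigma>h n \<in> borel_measurable (vec_borel n)"
    and lasso: "\<And>n y. y \<in> carrier_vec n \<Longrightarrow> (\<exists>b s. is_scaled_lasso (X n) y (lam0 n) b s) \<Longrightarrow>
       is_scaled_lasso (X n) y (lam0 n) (\<beta>h n y) (\<sigma>h n y)"
    and \<epsilon>: "\<epsilon> > 0"
  shows "(\<lambda>n. measure (gauss_pr (X n) (\<beta>s n) (\<sigma> n))
     {y \<in> carrier_vec n. \<bar>\<sigma>h n y / \<sigma> n - 1\<bar> > \<epsilon>}) \<longlonglongrightarrow> 0"
proof -
  define a where "a = A * (\<xi> - 1) / (\<xi> + 1)"
  have a: "a > 1"
    using A \<xi> by (simp add: a_def pos_divide_less_eq)
  have "0 < (\<xi> + 1) / (\<xi> - 1)"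
    using \<xi> by simp
  then have A_pos: "A > 0"
    using A by linarith
  define u where "u = 1 / a"
  have u: "u < 1"
    using a by (simp add: u_def)
  \<comment> \<open>The last entry gives
    \<open>(1 - \<delta>)\<^sup>2 \<ge> 1 - 2 * \<delta> > 1 / a\<close>, so the constant
    \<open>c\<close> stays above 1; the other two serve \<open>\<delta> \<le> 1 / 2\<close> and
    \<open>4 * \<delta> \<le> \<epsilon>\<close>.\<close>
  define \<delta> where "\<delta> = min (1 / 2) (min (\<epsilon> / 4) ((1 - u) / 4))"
  have \<delta>: "0 < \<delta>" "\<delta> \<le> 1 / 2" "4 * \<delta> \<le> \<epsilon>"
    using u \<epsilon> by (auto simp: \<delta>_def)
  have "\<delta> \<le> (1 - u) / 4"
    unfolding \<delta>_def by (intro min.coboundedI2 order_refl)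
  with u have "u < 1 - 2 * \<delta>"
    by simp
  also have "\<dots> \<le> (1 - \<delta>)\<^sup>2"
    by (simp add: power2_eq_square algebra_simps)
  finally have "u < (1 - \<delta>)\<^sup>2" .
  moreover define c where "c = (1 - \<delta>)\<^sup>2 * a"
  ultimately have "c > 1"
    using a by (simp add: c_def u_def pos_divide_less_eq)
  then have c2: "1 - c\<^sup>2 < 0"
    by (simp add: one_less_power)
  define bound where "bound n = 2 * exp (- (\<delta>\<^sup>2 / 16) * real n) + 2 * real (p n) powr (1 - c\<^sup>2)" for n
  have "(\<lambda>n. exp (- (\<delta>\<^sup>2 / 16) * real n)) \<longlonglongrightarrow> 0"
    using \<delta>(1) by real_asymp
  moreover have "(\<lambda>n. real (p n) powr (1 - c\<^sup>2)) \<longlonglongrightarrow> 0"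
    using c2 by (rule tendsto_neg_powr) (rule filterlim_compose[OF filterlim_real_sequentially p])
  ultimately have "bound \<longlonglongrightarrow> 2 * 0 + 2 * 0"
    unfolding bound_def by (intro tendsto_intros)
  then have bound: "bound \<longlonglongrightarrow> 0"
    by simp
  have "eventually (\<lambda>n. eta_star (X n) (\<beta>s n) (\<sigma> n * lam0 n) \<xi> / (\<sigma> n)\<^sup>2 < (\<delta> / 3)\<^sup>2) sequentially"
    using eta \<delta>(1) by (intro order_tendstoD(2)) auto
  moreover have "eventually (\<lambda>n. p n \<ge> 2) sequentially"
    using p by (simp add: filterlim_at_top)
  ultimately have "eventually (\<lambda>n. measure (gauss_pr (X n) (\<beta>s n) (\<sigma> n))
     {y \<in> carrier_vec n. \<bar>\<sigma>h n y / \<sigma> n - 1\<bar> > \<epsilon>} \<le> bound n) sequentially"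
    using eventually_gt_at_top[of 0]
  proof eventually_elim
    case (elim n)
    then show ?case
      unfolding bound_def c_def a_def
      using gauss_pr_scaled_lasso_deviation_le[OF X \<beta>s cols _ _ \<sigma> \<xi> A_pos \<delta>(1-3) lam0 _ meas lasso, of n]
      by simp
  qed
  then show ?thesis
    by (intro tendsto_sandwich[OF _ _ tendsto_const bound]) auto
qed

theorem theorem1:
  shows
    "(\<forall>(n::nat) (p::nat) (X::real mat) (y::real vec) (\<beta>s::real vec) (lam0::real) (\<xi>::real)
        (\<beta>h::real vec) (\<sigma>h::real).
        X \<in> carrier_mat n p \<and> y \<in> carrier_vec n \<and> \<beta>s \<in> carrier_vec p \<and> lam0 > 0 \<and> \<xi> > 1 \<and>
        is_scaled_lasso X y lam0 \<beta>h \<sigma>h \<and>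
        sigma_star X y \<beta>s > 0 \<and>
        z_star X y \<beta>s \<le> (1 - tau0 X y \<beta>s lam0 \<xi>) * lam0 * (\<xi> - 1) / (\<xi> + 1)
        \<longrightarrow>
        (let \<sigma>s = sigma_star X y \<beta>s;
             \<tau> = tau0 X y \<beta>s lam0 \<xi>;
             mid = (if \<tau> = 1 then \<infinity>
                    else ereal (1 / \<sigma>s * sqrt (eta_star X \<beta>s (\<sigma>s * lam0 / (1 - \<tau>)) \<xi>)))
         in max (1 - \<sigma>h / \<sigma>s) (1 - \<sigma>s / \<sigma>h) \<le> \<tau> \<and>
            ereal (l2_norm (X *\<^sub>v \<beta>h - X *\<^sub>v \<beta>s) / (sqrt (real n) * \<sigma>s)) \<le> mid \<and>
            mid \<le> (if \<tau> = 1 then \<infinity> else ereal (\<tau> / (1 - \<tau>)))))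
     \<and>
     (\<forall>(p::nat \<Rightarrow> nat) (X::nat \<Rightarrow> real mat) (\<beta>s::nat \<Rightarrow> real vec) (\<sigma>::nat \<Rightarrow> real)
        (lam0::nat \<Rightarrow> real) (\<xi>::real) (A::real)
        (\<beta>h::nat \<Rightarrow> real vec \<Rightarrow> real vec) (\<sigma>h::nat \<Rightarrow> real vec \<Rightarrow> real).
        filterlim p at_top sequentially \<and>
        (\<forall>n. X n \<in> carrier_mat n (p n) \<and> \<beta>s n \<in> carrier_vec (p n) \<and> \<sigma> n > 0) \<and>
        (\<forall>n. \<forall>j<p n. (l2_norm (col (X n) j))\<^sup>2 = real n) \<and>
        \<xi> > 1 \<and> A > (\<xi> + 1) / (\<xi> - 1) \<and>
        (\<forall>n. lam0 n = A * sqrt (2 / real n * ln (real (p n)))) \<and>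
        (\<lambda>n. eta_star (X n) (\<beta>s n) (\<sigma> n * lam0 n) \<xi> / (\<sigma> n)\<^sup>2) \<longlonglongrightarrow> 0 \<and>
        (\<forall>n. \<sigma>h n \<in> borel_measurable (vec_borel n)) \<and>
        (\<forall>n. \<forall>y\<in>carrier_vec n. (\<exists>b s. is_scaled_lasso (X n) y (lam0 n) b s) \<longrightarrow>
           is_scaled_lasso (X n) y (lam0 n) (\<beta>h n y) (\<sigma>h n y))
        \<longrightarrow>
        (\<forall>\<epsilon>>0. (\<lambda>n. measure (gauss_pr (X n) (\<beta>s n) (\<sigma> n))
                   {y \<in> carrier_vec n. \<bar>\<sigma>h n y / \<sigma> n - 1\<bar> > \<epsilon>}) \<longlonglongrightarrow> 0))"
proof (rule conjI, goal_cases)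
  case 1
  show ?case
    by (intro allI impI, elim conjE) (rule scaled_lasso_deterministic)
next
  case 2
  show ?case
    by (intro allI impI, elim conjE) (rule scaled_lasso_noise_level_consistent; blast)
qed

end
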